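(* Consider the real-valued focusing modified Korteweg--de Vries equation $$\tfrac{d}{dt}q=-q'''-2(q^3)'$$ on $\mathbb{R}$. (i) For any sequence of nonzero times $t_n\to0$, there is a sequence of real-valued Schwartz-class solutions $q_n$ of this equation and a constant $C$ such that $$\|q_n(0)\|_{\dot H^{-\frac12}(\mathbb{R})}\le C\ \text{ for all } n\qquad\text{and}\qquad\|q_n(t_n)\|_{H^{-\frac12}(\mathbb{R})}\to\infty\ \text{ as } n\to\infty .$$ (ii) For every $\sigma<-\frac12$, instantaneous norm inflation holds in $H^\sigma$: for every $\varepsilon>0$ there is a real-valued Schwartz solution $q$ of this equation with $$\|q(0)\|_{H^\sigma(\mathbb{R})}<\varepsilon\qquad\text{and}\qquad\sup_{|t|<\varepsilon}\|q(t)\|_{H^\sigma(\mathbb{R})}>\varepsilon^{-1}.$$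
   Context: Primes denote $x$-derivatives. $\dot H^{-1/2}$ denotes the homogeneous Sobolev space with norm $\|f\|_{\dot H^{-1/2}}^2=\int|\xi|^{-1}|\hat f(\xi)|^2\,d\xi$, and $H^\sigma$ the inhomogeneous Sobolev space. A Schwartz-class solution is one that is continuous in time with values in the Schwartz space $\mathcal S(\mathbb{R})$. *)

theory Defs
  imports "HOL-Analysis.Analysis"
begin

definition schwartz :: "(real \<Rightarrow> real) \<Rightarrow> bool" where
  "schwartz f \<longleftrightarrow>
     (\<forall>m x. ((deriv ^^ m) f) differentiable (at x)) \<and>
     (\<forall>k m. bounded (range (\<lambda>x. x ^ k * (deriv ^^ m) f x)))"

(* A genuine supremum only for Schwartz f; a real Sup of an unbounded set is unspecified. *)
definition schwartz_seminorm :: "nat \<Rightarrow> nat \<Rightarrow> (real \<Rightarrow> real) \<Rightarrow> real" where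
  "schwartz_seminorm k m f = (SUP x. \<bar>x ^ k * (deriv ^^ m) f x\<bar>)"

definition continuous_in_schwartz :: "(real \<Rightarrow> real \<Rightarrow> real) \<Rightarrow> bool" where
  "continuous_in_schwartz q \<longleftrightarrow>
     (\<forall>t. schwartz (q t)) \<and>
     (\<forall>t0 k m. ((\<lambda>t. schwartz_seminorm k m (\<lambda>x. q t x - q t0 x)) \<longlongrightarrow> 0) (at t0))"

(* Arguments of q are time, then space; the solution is global in time, and the
   equation is required pointwise. *)
definition schwartz_solution_mkdv :: "(real \<Rightarrow> real \<Rightarrow> real) \<Rightarrow> bool" where
  "schwartz_solution_mkdv q \<longleftrightarrow>
     continuous_in_schwartz q \<and>
     (\<forall>t x. ((\<lambda>s. q s x) has_real_derivative
        (- (deriv ^^ 3) (q t) x - 2 * deriv (\<lambda>y. (q t y) ^ 3) x)) (at t))"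

(* Unitary normalization: (2 pi)^(-1/2) * integral of exp(-i xi x) f(x) dx. *)
definition fourier :: "(real \<Rightarrow> real) \<Rightarrow> real \<Rightarrow> complex" where
  "fourier f \<xi> =
     complex_of_real (1 / sqrt (2 * pi)) * (LINT x|lborel. cis (- (\<xi> * x)) * complex_of_real (f x))"

(* Square root extended by sqrt infinity = infinity. *)
definition ennsqrt :: "ennreal \<Rightarrow> ennreal" where
  "ennsqrt a = (if a = \<infinity> then \<infinity> else ennreal (sqrt (enn2real a)))"

definition sobolev_norm :: "real \<Rightarrow> (real \<Rightarrow> real) \<Rightarrow> ennreal" where
  "sobolev_norm s f =
     ennsqrt (\<integral>\<^sup>+ \<xi>. ennreal ((1 + \<xi>\<^sup>2) powr s * (cmod (fourier f \<xi>))\<^sup>2) \<partial>lborel)"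

(* Extended-valued because for s <= -1/2 it is infinite on Schwartz functions of nonzero
   mean.  The convention 0 powr a = 0 only affects the null set {0}. *)
definition hom_sobolev_norm :: "real \<Rightarrow> (real \<Rightarrow> real) \<Rightarrow> ennreal" where
  "hom_sobolev_norm s f =
     ennsqrt (\<integral>\<^sup>+ \<xi>. ennreal (\<bar>\<xi>\<bar> powr (2 * s) * (cmod (fourier f \<xi>))\<^sup>2) \<partial>lborel)"

end

theory Submission
  imports Defs
begin

text \<open>
  Take a multisoliton of total mass zero, with alternating signs and distinct speeds. At time 0 its
  Fourier transform vanishes at frequency 0, so after the scaling
  \<open>q\<^sub>l(t, x) = l q(l\<^sup>3 t, l x)\<close> with \<open>l\<close> large its norm in \<open>H\<^sup>\<sigma>\<close> (for \<open>\<sigma> < -1/2\<close>) is small, while the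
  scale-invariant homogeneous norm of order \<open>-1/2\<close> does not depend on \<open>l\<close>. At the small time \<open>1/l\<^sup>2\<close> the solitons have moved
  apart by distances of order 1 and \<open>q\<^sub>l\<close> is close to a sum of point masses of alternating signs at the
  points \<open>4 k\<^sub>i\<^sup>2\<close>. Its Fourier transform then tends to a trigonometric polynomial, whose energy per
  period is proportional to the number of solitons. By Fatou's lemma two solitons make the norm in
  \<open>H\<close> of order \<open>-1/2\<close> blow up, and many solitons make the norm in \<open>H\<^sup>\<sigma>\<close> as large as required.

  The multisolitons come from iterated Darboux transformations of the zero solution, driven by real
  solutions \<open>(a, b)\<close> of the Lax pair, so that no denominator \<open>a\<^sup>2 + b\<^sup>2\<close> vanishes. Increasing spectral
  parameters make each Darboux matrix positive definite, hence it turns \<open>(a, b)\<close> by less than a right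
  angle; this determines the potential \<open>\<integral> q\<close> up to an integrable error, without any analysis of soliton
  interactions.
\<close>

subsection \<open>Lax pair and Darboux transformation\<close>

text \<open>At frequency \<eta> / T and internal time T, a term (d/dx) R with R bounded in L^1
  uniformly in time contributes only O(1/T). Hence the solution has to be known only up to such a
  derivative, and the phase shifts left by collisions, being bounded translations, disappear in R.
  This is why the argument controls an angle, that is, a potential of the solution, instead of the
  solution itself. All solitons carry the same mass, so an even number of them with alternating
  signs has mass zero. Negative times are reached with negative l: the factor -1 reverses time and
  space, and if l has the sign of t, the internal time l^3 t = |l| is positive. The exponent -1/2 is
  the borderline. A fixed energy per period, weighted by 1 / |\<eta>|, sums like the harmonic
  series, so two solitons are enough. Below -1/2 the weights are summable, and the gain must come
  from the energy of a single period, hence from the number of solitons.\<close>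

definition x_deriv :: "(real \<Rightarrow> real \<Rightarrow> real) \<Rightarrow> (real \<Rightarrow> real \<Rightarrow> real) \<Rightarrow> bool" where
  "x_deriv f g \<longleftrightarrow> (\<forall>t x. (f t has_real_derivative g t x) (at x))"

definition t_deriv :: "(real \<Rightarrow> real \<Rightarrow> real) \<Rightarrow> (real \<Rightarrow> real \<Rightarrow> real) \<Rightarrow> bool" where
  "t_deriv f g \<longleftrightarrow> (\<forall>t x. ((\<lambda>s. f s x) has_real_derivative g t x) (at t))"

text \<open>The nonlinearity is expanded and the spatial derivatives are carried along as named
  functions, so that a Darboux step becomes an identity between polynomials.\<close>

definition mkdv_jet :: "(real \<Rightarrow> real \<Rightarrow> real) \<Rightarrow> (real \<Rightarrow> real \<Rightarrow> real) \<Rightarrow> (real \<Rightarrow> real \<Rightarrow> real) \<Rightarrow>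
    (real \<Rightarrow> real \<Rightarrow> real) \<Rightarrow> bool" where
  "mkdv_jet q q1 q2 q3 \<longleftrightarrow> x_deriv q q1 \<and> x_deriv q1 q2 \<and> x_deriv q2 q3 \<and>
     t_deriv q (\<lambda>t x. - q3 t x - 6 * (q t x)\<^sup>2 * q1 t x)"

text \<open>The Zakharov-Shabat (AKNS) system at the purely imaginary spectral parameter i k, where
  its coefficients are real. Both matrices are trace-free.\<close>

definition lax_pair :: "real \<Rightarrow> (real \<Rightarrow> real \<Rightarrow> real) \<Rightarrow> (real \<Rightarrow> real \<Rightarrow> real) \<Rightarrow> (real \<Rightarrow> real \<Rightarrow> real) \<Rightarrow>
    (real \<Rightarrow> real \<Rightarrow> real) \<Rightarrow> (real \<Rightarrow> real \<Rightarrow> real) \<Rightarrow> bool" where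
  "lax_pair k q q1 q2 a b \<longleftrightarrow>
     x_deriv a (\<lambda>t x. k * a t x + q t x * b t x) \<and>
     x_deriv b (\<lambda>t x. - q t x * a t x - k * b t x) \<and>
     t_deriv a (\<lambda>t x. (- 4 * k ^ 3 - 2 * k * (q t x)\<^sup>2) * a t x
       + (- 4 * k\<^sup>2 * q t x - 2 * k * q1 t x - q2 t x - 2 * (q t x) ^ 3) * b t x) \<and>
     t_deriv b (\<lambda>t x. (4 * k\<^sup>2 * q t x - 2 * k * q1 t x + q2 t x + 2 * (q t x) ^ 3) * a t x
       + (4 * k ^ 3 + 2 * k * (q t x)\<^sup>2) * b t x)"

text \<open>\<open>cos_double a b\<close> and \<open>sin_double a b\<close> are the cosine and sine of twice the polar angle of \<open>(a, b)\<close>.\<close>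

definition cos_double :: "real \<Rightarrow> real \<Rightarrow> real" where
  "cos_double a b = (a\<^sup>2 - b\<^sup>2) / (a\<^sup>2 + b\<^sup>2)"

definition sin_double :: "real \<Rightarrow> real \<Rightarrow> real" where
  "sin_double a b = 2 * a * b / (a\<^sup>2 + b\<^sup>2)"

lemma double_circle:
  assumes "a\<^sup>2 + b\<^sup>2 \<noteq> 0"
  shows "(cos_double a b)\<^sup>2 + (sin_double a b)\<^sup>2 = 1"
proof -
  have "(cos_double a b)\<^sup>2 + (sin_double a b)\<^sup>2 = ((a\<^sup>2 - b\<^sup>2)\<^sup>2 + (2 * a * b)\<^sup>2) / (a\<^sup>2 + b\<^sup>2)\<^sup>2"
    by (simp add: cos_double_def sin_double_def power_divide add_divide_distrib)
  also have "(a\<^sup>2 - b\<^sup>2)\<^sup>2 + (2 * a * b)\<^sup>2 = (a\<^sup>2 + b\<^sup>2)\<^sup>2"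
    by algebra
  finally show ?thesis using assms by simp
qed

text \<open>\<open>p\<close> is 2 (a b' - b a') / r with r = a^2 + b^2, the angular velocity of the
  doubled angle, rewritten by a^2 / r = (1 + c) / 2, b^2 / r = (1 - c) / 2 and 2 a b / r = s. The
  trace-free form covers the x-equation and the t-equation of the Lax pair alike.\<close>

lemma double_derivatives:
  fixes a b :: "real \<Rightarrow> real"
  assumes a: "(a has_real_derivative \<alpha> * a y + \<beta> * b y) (at y)"
    and b: "(b has_real_derivative \<gamma> * a y - \<alpha> * b y) (at y)"
    and nz: "(a y)\<^sup>2 + (b y)\<^sup>2 \<noteq> 0"
  defines "c \<equiv> cos_double (a y) (b y)" and "s \<equiv> sin_double (a y) (b y)"
  defines "p \<equiv> \<gamma> * (1 + c) - 2 * \<alpha> * s - \<beta> * (1 - c)"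
  shows "((\<lambda>y. cos_double (a y) (b y)) has_real_derivative - s * p) (at y)"
    and "((\<lambda>y. sin_double (a y) (b y)) has_real_derivative c * p) (at y)"
proof -
  define r where "r = (a y)\<^sup>2 + (b y)\<^sup>2"
  have r: "r \<noteq> 0" using nz r_def by simp
  have "((\<lambda>y. cos_double (a y) (b y)) has_real_derivative
     ((2 * a y * (\<alpha> * a y + \<beta> * b y) - 2 * b y * (\<gamma> * a y - \<alpha> * b y)) * r
       - ((a y)\<^sup>2 - (b y)\<^sup>2) * (2 * a y * (\<alpha> * a y + \<beta> * b y) + 2 * b y * (\<gamma> * a y - \<alpha> * b y))) / (r * r)) (at y)"
    unfolding cos_double_def r_def using nz
    by (auto intro!: derivative_eq_intros a b simp: power2_eq_square algebra_simps)
  moreover have "((2 * a y * (\<alpha> * a y + \<beta> * b y) - 2 * b y * (\<gamma> * a y - \<alpha> * b y)) * r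
       - ((a y)\<^sup>2 - (b y)\<^sup>2) * (2 * a y * (\<alpha> * a y + \<beta> * b y) + 2 * b y * (\<gamma> * a y - \<alpha> * b y))) / (r * r) = - s * p"
    unfolding s_def p_def c_def sin_double_def cos_double_def r_def[symmetric]
    using r apply (simp add: divide_simps) unfolding r_def by algebra
  ultimately show "((\<lambda>y. cos_double (a y) (b y)) has_real_derivative - s * p) (at y)" by simp
  have "((\<lambda>y. sin_double (a y) (b y)) has_real_derivative
     ((2 * (\<alpha> * a y + \<beta> * b y) * b y + 2 * a y * (\<gamma> * a y - \<alpha> * b y)) * r
       - 2 * a y * b y * (2 * a y * (\<alpha> * a y + \<beta> * b y) + 2 * b y * (\<gamma> * a y - \<alpha> * b y))) / (r * r)) (at y)"
    unfolding sin_double_def r_def using nz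
    by (auto intro!: derivative_eq_intros a b simp: power2_eq_square algebra_simps)
  moreover have "((2 * (\<alpha> * a y + \<beta> * b y) * b y + 2 * a y * (\<gamma> * a y - \<alpha> * b y)) * r
       - 2 * a y * b y * (2 * a y * (\<alpha> * a y + \<beta> * b y) + 2 * b y * (\<gamma> * a y - \<alpha> * b y))) / (r * r) = c * p"
    unfolding s_def p_def c_def sin_double_def cos_double_def r_def[symmetric]
    using r apply (simp add: divide_simps) unfolding r_def by algebra
  ultimately show "((\<lambda>y. sin_double (a y) (b y)) has_real_derivative c * p) (at y)" by simp
qed

text \<open>The time derivative of twice the polar angle of a solution of the Lax pair.\<close>

definition angle_flow :: "real \<Rightarrow> (real \<Rightarrow> real \<Rightarrow> real) \<Rightarrow> (real \<Rightarrow> real \<Rightarrow> real) \<Rightarrow> (real \<Rightarrow> real \<Rightarrow> real) \<Rightarrow>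
    (real \<Rightarrow> real \<Rightarrow> real) \<Rightarrow> (real \<Rightarrow> real \<Rightarrow> real) \<Rightarrow> real \<Rightarrow> real \<Rightarrow> real" where
  "angle_flow k q q1 q2 c s t x =
     8 * k\<^sup>2 * q t x + 2 * q2 t x + 4 * (q t x * (q t x * q t x)) + (- 4 * k) * (c t x * q1 t x)
     + (8 * k ^ 3 * s t x + 4 * k * (s t x * (q t x * q t x)))"

lemma lax_pair_angle:
  assumes lax: "lax_pair k q q1 q2 a b" and nz: "\<And>t x. (a t x)\<^sup>2 + (b t x)\<^sup>2 \<noteq> 0"
  defines "c \<equiv> \<lambda>t x. cos_double (a t x) (b t x)" and "s \<equiv> \<lambda>t x. sin_double (a t x) (b t x)"
  shows "x_deriv c (\<lambda>t x. 2 * (s t x * (k * s t x + q t x)))"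
    and "x_deriv s (\<lambda>t x. - 2 * (c t x * (k * s t x + q t x)))"
    and "t_deriv c (\<lambda>t x. - 1 * (s t x * angle_flow k q q1 q2 c s t x))"
    and "t_deriv s (\<lambda>t x. c t x * angle_flow k q q1 q2 c s t x)"
proof -
  have ax: "(a t has_real_derivative k * a t x + q t x * b t x) (at x)"
    and bx: "(b t has_real_derivative (- q t x) * a t x - k * b t x) (at x)"
    and at: "((\<lambda>t. a t x) has_real_derivative (- 4 * k ^ 3 - 2 * k * (q t x)\<^sup>2) * a t x
       + (- 4 * k\<^sup>2 * q t x - 2 * k * q1 t x - q2 t x - 2 * (q t x) ^ 3) * b t x) (at t)"
    and bt: "((\<lambda>t. b t x) has_real_derivative (4 * k\<^sup>2 * q t x - 2 * k * q1 t x + q2 t x + 2 * (q t x) ^ 3) * a t x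
       - (- 4 * k ^ 3 - 2 * k * (q t x)\<^sup>2) * b t x) (at t)" for t x
    using lax unfolding lax_pair_def x_deriv_def t_deriv_def by (auto simp: algebra_simps)
  show "x_deriv c (\<lambda>t x. 2 * (s t x * (k * s t x + q t x)))"
    unfolding x_deriv_def c_def s_def
    apply (intro allI)
    subgoal for t x
      by (rule DERIV_cong[OF double_derivatives(1)[OF ax bx nz]]) (simp add: algebra_simps)
    done
  show "x_deriv s (\<lambda>t x. - 2 * (c t x * (k * s t x + q t x)))"
    unfolding x_deriv_def c_def s_def
    apply (intro allI)
    subgoal for t x
      by (rule DERIV_cong[OF double_derivatives(2)[OF ax bx nz]]) (simp add: algebra_simps)
    done
  show "t_deriv c (\<lambda>t x. - 1 * (s t x * angle_flow k q q1 q2 c s t x))"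
    unfolding t_deriv_def c_def s_def angle_flow_def
    apply (intro allI)
    subgoal for t x
      by (rule DERIV_cong[OF double_derivatives(1)[OF at bt nz]]) (simp add: algebra_simps power2_eq_square power3_eq_cube)
    done
  show "t_deriv s (\<lambda>t x. c t x * angle_flow k q q1 q2 c s t x)"
    unfolding t_deriv_def c_def s_def angle_flow_def
    apply (intro allI)
    subgoal for t x
      by (rule DERIV_cong[OF double_derivatives(2)[OF at bt nz]]) (simp add: algebra_simps power2_eq_square power3_eq_cube)
    done
qed

text \<open>The driving solution enters a Darboux step only through its doubled angle. Assuming just
  a point (c, s) on the circle with the evolution found in \<open>lax_pair_angle\<close> removes all
  denominators.\<close>

locale darboux =
  fixes k :: real and q q1 q2 q3 c s :: "real \<Rightarrow> real \<Rightarrow> real"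
  assumes jet: "mkdv_jet q q1 q2 q3"
    and circle: "\<And>t x. (c t x)\<^sup>2 + (s t x)\<^sup>2 = 1"
    and cx: "x_deriv c (\<lambda>t x. 2 * (s t x * (k * s t x + q t x)))"
    and sx: "x_deriv s (\<lambda>t x. - 2 * (c t x * (k * s t x + q t x)))"
    and ct: "t_deriv c (\<lambda>t x. - 1 * (s t x * angle_flow k q q1 q2 c s t x))"
    and st: "t_deriv s (\<lambda>t x. c t x * angle_flow k q q1 q2 c s t x)"
begin

definition Q :: "real \<Rightarrow> real \<Rightarrow> real" where "Q t x = q t x + 2 * k * s t x"

text \<open>\<open>Q1\<close>, \<open>Q2\<close>, \<open>Q3\<close> are the successive x-derivatives
  of \<open>Q\<close>, expanded by the evolution of \<open>c\<close> and \<open>s\<close>. Writing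
  them as sums of scaled nested products fits the closure rules of \<open>decay_alg\<close>.\<close>

definition Q1 :: "real \<Rightarrow> real \<Rightarrow> real" where
  "Q1 t x = q1 t x + (- 4 * k\<^sup>2) * (c t x * s t x) + (- 4 * k) * (c t x * q t x)"

definition Q2 :: "real \<Rightarrow> real \<Rightarrow> real" where
  "Q2 t x = q2 t x + 8 * k ^ 3 * (c t x * (c t x * s t x)) + (- 8 * k ^ 3) * (s t x * (s t x * s t x))
     + 8 * k\<^sup>2 * (c t x * (c t x * q t x)) + (- 16 * k\<^sup>2) * (s t x * (s t x * q t x))
     + (- 8 * k) * (q t x * (q t x * s t x)) + (- 4 * k) * (c t x * q1 t x)"

definition Q3 :: "real \<Rightarrow> real \<Rightarrow> real" where
  "Q3 t x = q3 t x + (- 16 * k ^ 4) * (c t x * (c t x * (c t x * s t x)))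
     + 80 * k ^ 4 * (c t x * (s t x * (s t x * s t x)))
     + (- 16 * k ^ 3) * (c t x * (c t x * (c t x * q t x)))
     + 176 * k ^ 3 * (c t x * (s t x * (s t x * q t x)))
     + 112 * k\<^sup>2 * (c t x * (q t x * (q t x * s t x)))
     + 8 * k\<^sup>2 * (c t x * (c t x * q1 t x)) + (- 24 * k\<^sup>2) * (s t x * (s t x * q1 t x))
     + 16 * k * (c t x * (q t x * (q t x * q t x))) + (- 24 * k) * (q t x * (q1 t x * s t x))
     + (- 4 * k) * (c t x * q2 t x)"

lemmas x_ders =
  cx[unfolded x_deriv_def, rule_format] sx[unfolded x_deriv_def, rule_format]
  jet[unfolded mkdv_jet_def x_deriv_def, THEN conjunct1, rule_format]
  jet[unfolded mkdv_jet_def x_deriv_def, THEN conjunct2, THEN conjunct1, rule_format]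
  jet[unfolded mkdv_jet_def x_deriv_def, THEN conjunct2, THEN conjunct2, THEN conjunct1, rule_format]

lemmas t_ders =
  ct[unfolded t_deriv_def, rule_format] st[unfolded t_deriv_def, rule_format]
  jet[unfolded mkdv_jet_def t_deriv_def, THEN conjunct2, THEN conjunct2, THEN conjunct2, rule_format]

lemma jet_Q: "mkdv_jet Q Q1 Q2 Q3"
  unfolding mkdv_jet_def
proof (intro conjI)
  show "x_deriv Q Q1"
    unfolding x_deriv_def Q_def Q1_def
    by (auto intro!: derivative_eq_intros x_ders simp: algebra_simps power2_eq_square)
  show "x_deriv Q1 Q2"
    unfolding x_deriv_def Q1_def Q2_def
    by (auto intro!: derivative_eq_intros x_ders simp: algebra_simps power2_eq_square power3_eq_cube)
  show "x_deriv Q2 Q3"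
    unfolding x_deriv_def Q2_def Q3_def
    by (auto intro!: derivative_eq_intros x_ders simp: algebra_simps power2_eq_square power3_eq_cube power4_eq_xxxx)
  show "t_deriv Q (\<lambda>t x. - Q3 t x - 6 * (Q t x)\<^sup>2 * Q1 t x)"
    unfolding t_deriv_def
  proof (intro allI)
    fix t x
    have d: "((\<lambda>t. Q t x) has_real_derivative (- q3 t x - 6 * (q t x)\<^sup>2 * q1 t x)
       + 2 * k * (c t x * angle_flow k q q1 q2 c s t x)) (at t)"
      unfolding Q_def by (auto intro!: derivative_eq_intros t_ders)
    show "((\<lambda>t. Q t x) has_real_derivative (- Q3 t x - 6 * (Q t x)\<^sup>2 * Q1 t x)) (at t)"
      apply (rule DERIV_cong[OF d])
      unfolding Q_def Q1_def Q3_def angle_flow_def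
      \<comment> \<open>Modulo c^2 + s^2 = 1 this is an identity between polynomials.\<close>
      using circle[of t x] by algebra
  qed
qed

text \<open>The Darboux matrix is K minus k times the reflection that fixes the line of the driving
  vector. At K = k it annihilates that vector, so each step uses up one spectral parameter.\<close>

lemma lax_Q:
  assumes lax: "lax_pair K q q1 q2 a b"
  shows "lax_pair K Q Q1 Q2
    (\<lambda>t x. K * a t x - k * (c t x * a t x + s t x * b t x))
    (\<lambda>t x. K * b t x - k * (s t x * a t x - c t x * b t x))"
proof -
  have ax: "(a t has_real_derivative K * a t x + q t x * b t x) (at x)"
    and bx: "(b t has_real_derivative (- q t x) * a t x - K * b t x) (at x)"
    and at: "((\<lambda>t. a t x) has_real_derivative (- 4 * K ^ 3 - 2 * K * (q t x)\<^sup>2) * a t x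
       + (- 4 * K\<^sup>2 * q t x - 2 * K * q1 t x - q2 t x - 2 * (q t x) ^ 3) * b t x) (at t)"
    and bt: "((\<lambda>t. b t x) has_real_derivative (4 * K\<^sup>2 * q t x - 2 * K * q1 t x + q2 t x + 2 * (q t x) ^ 3) * a t x
       + (4 * K ^ 3 + 2 * K * (q t x)\<^sup>2) * b t x) (at t)" for t x
    using lax unfolding lax_pair_def x_deriv_def t_deriv_def by auto
  show ?thesis
    unfolding lax_pair_def x_deriv_def t_deriv_def
    apply (intro conjI allI)
    subgoal for t x
      apply (rule DERIV_cong)
       apply (rule derivative_intros x_ders ax bx)+
      by (simp add: Q_def algebra_simps)
    subgoal for t x
      apply (rule DERIV_cong)
       apply (rule derivative_intros x_ders ax bx)+
      by (simp add: Q_def algebra_simps)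
    subgoal for t x
      apply (rule DERIV_cong)
       apply (rule derivative_intros t_ders at bt)+
      unfolding Q_def Q1_def Q2_def angle_flow_def using circle[of t x] by algebra
    subgoal for t x
      apply (rule DERIV_cong)
       apply (rule derivative_intros t_ders at bt)+
      unfolding Q_def Q1_def Q2_def angle_flow_def using circle[of t x] by algebra
    done
qed

end

section \<open>The algebra of decaying functions\<close>

text \<open>Contains all derivatives of the multisoliton: it is closed under differentiation because the
  derivatives of \<open>C i\<close> and \<open>S i\<close> are polynomials in these functions, each term with a factor \<open>S j\<close>.\<close>

inductive_set decay_alg :: "(nat \<Rightarrow> real \<Rightarrow> real \<Rightarrow> real) \<Rightarrow> (nat \<Rightarrow> real \<Rightarrow> real \<Rightarrow> real) \<Rightarrow> nat \<Rightarrow>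
    (real \<Rightarrow> real \<Rightarrow> real) set"
  for C S :: "nat \<Rightarrow> real \<Rightarrow> real \<Rightarrow> real" and n :: nat where
  zero: "(\<lambda>t x. 0) \<in> decay_alg C S n"
| gen: "i < n \<Longrightarrow> S i \<in> decay_alg C S n"
| add: "f \<in> decay_alg C S n \<Longrightarrow> g \<in> decay_alg C S n \<Longrightarrow> (\<lambda>t x. f t x + g t x) \<in> decay_alg C S n"
| scale: "f \<in> decay_alg C S n \<Longrightarrow> (\<lambda>t x. r * f t x) \<in> decay_alg C S n"
| mulC: "i < n \<Longrightarrow> f \<in> decay_alg C S n \<Longrightarrow> (\<lambda>t x. C i t x * f t x) \<in> decay_alg C S n"
| mul: "f \<in> decay_alg C S n \<Longrightarrow> g \<in> decay_alg C S n \<Longrightarrow> (\<lambda>t x. f t x * g t x) \<in> decay_alg C S n"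

lemma decay_alg_mono:
  assumes "f \<in> decay_alg C S m" "m \<le> n"
  shows "f \<in> decay_alg C S n"
  using assms by (induction rule: decay_alg.induct) (auto intro: decay_alg.intros)

definition has_derivs_in :: "(real \<Rightarrow> real \<Rightarrow> real) \<Rightarrow> (real \<Rightarrow> real \<Rightarrow> real) set \<Rightarrow> bool" where
  "has_derivs_in f G \<longleftrightarrow> (\<exists>g\<in>G. x_deriv f g) \<and> (\<exists>g\<in>G. t_deriv f g)"

lemma has_derivs_inI: "x_deriv f g \<Longrightarrow> t_deriv f h \<Longrightarrow> g \<in> G \<Longrightarrow> h \<in> G \<Longrightarrow> has_derivs_in f G"
  unfolding has_derivs_in_def by blast

lemma has_derivs_in_mono: "has_derivs_in f G \<Longrightarrow> G \<subseteq> H \<Longrightarrow> has_derivs_in f H"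
  unfolding has_derivs_in_def by blast

lemma x_deriv_add: "x_deriv f f' \<Longrightarrow> x_deriv g g' \<Longrightarrow> x_deriv (\<lambda>t x. f t x + g t x) (\<lambda>t x. f' t x + g' t x)"
  and t_deriv_add: "t_deriv f f' \<Longrightarrow> t_deriv g g' \<Longrightarrow> t_deriv (\<lambda>t x. f t x + g t x) (\<lambda>t x. f' t x + g' t x)"
  and x_deriv_mult: "x_deriv f f' \<Longrightarrow> x_deriv g g' \<Longrightarrow>
    x_deriv (\<lambda>t x. f t x * g t x) (\<lambda>t x. f' t x * g t x + f t x * g' t x)"
  and t_deriv_mult: "t_deriv f f' \<Longrightarrow> t_deriv g g' \<Longrightarrow>
    t_deriv (\<lambda>t x. f t x * g t x) (\<lambda>t x. f' t x * g t x + f t x * g' t x)"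
  and x_deriv_scale: "x_deriv f f' \<Longrightarrow> x_deriv (\<lambda>t x. r * f t x) (\<lambda>t x. r * f' t x)"
  and t_deriv_scale: "t_deriv f f' \<Longrightarrow> t_deriv (\<lambda>t x. r * f t x) (\<lambda>t x. r * f' t x)"
  and x_deriv_zero: "x_deriv (\<lambda>t x. 0) (\<lambda>t x. 0)"
  and t_deriv_zero: "t_deriv (\<lambda>t x. 0) (\<lambda>t x. 0)"
  unfolding x_deriv_def t_deriv_def by (auto intro!: derivative_eq_intros)

text \<open>By the product rule only the generators have to be checked. \<open>C i\<close> need not
  lie in the algebra, but its derivatives are assumed to, so both terms of the derivative of
  \<open>C i\<close> times \<open>f\<close> are again members.\<close>

lemma decay_alg_derivs:
  assumes gens: "\<And>i. i < n \<Longrightarrow> has_derivs_in (C i) (decay_alg C S n) \<and> has_derivs_in (S i) (decay_alg C S n)"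
    and f: "f \<in> decay_alg C S n"
  shows "has_derivs_in f (decay_alg C S n)"
  using f
proof induction
  case zero
  show ?case
    by (rule has_derivs_inI[OF x_deriv_zero t_deriv_zero]) (intro decay_alg.zero)+
next
  case (gen i)
  then show ?case using gens by blast
next
  case (add f g)
  then obtain fx ft gx gt where d: "x_deriv f fx" "t_deriv f ft" "fx \<in> decay_alg C S n" "ft \<in> decay_alg C S n"
    "x_deriv g gx" "t_deriv g gt" "gx \<in> decay_alg C S n" "gt \<in> decay_alg C S n"
    unfolding has_derivs_in_def by blast
  show ?case
    by (rule has_derivs_inI[OF x_deriv_add[OF d(1) d(5)] t_deriv_add[OF d(2) d(6)]]) (intro decay_alg.add d)+
next
  case (scale f r)
  then obtain fx ft where d: "x_deriv f fx" "t_deriv f ft" "fx \<in> decay_alg C S n" "ft \<in> decay_alg C S n"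
    unfolding has_derivs_in_def by blast
  show ?case
    by (rule has_derivs_inI[OF x_deriv_scale[OF d(1)] t_deriv_scale[OF d(2)]]) (intro decay_alg.scale d)+
next
  case (mulC i f)
  then obtain fx ft cx ct where d: "x_deriv f fx" "t_deriv f ft" "fx \<in> decay_alg C S n" "ft \<in> decay_alg C S n"
    "x_deriv (C i) cx" "t_deriv (C i) ct" "cx \<in> decay_alg C S n" "ct \<in> decay_alg C S n"
    using gens[of i] unfolding has_derivs_in_def by blast
  show ?case
    by (rule has_derivs_inI[OF x_deriv_mult[OF d(5) d(1)] t_deriv_mult[OF d(6) d(2)]]) (intro decay_alg.add decay_alg.mul[of _ _ _ _ f] decay_alg.mulC d mulC)+
next
  case (mul f g)
  then obtain fx ft gx gt where d: "x_deriv f fx" "t_deriv f ft" "fx \<in> decay_alg C S n" "ft \<in> decay_alg C S n"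
    "x_deriv g gx" "t_deriv g gt" "gx \<in> decay_alg C S n" "gt \<in> decay_alg C S n"
    unfolding has_derivs_in_def by blast
  show ?case
    by (rule has_derivs_inI[OF x_deriv_mult[OF d(1) d(5)] t_deriv_mult[OF d(2) d(6)]]) (intro decay_alg.add decay_alg.mul d mul)+
qed

subsection \<open>One Darboux step on vectors\<close>

text \<open>Cauchy-Schwarz for the unit vector (c, s) and the vector (a^2 - b^2, 2 a b) of length
  a^2 + b^2. The left side is the absolute value of the quadratic form of a reflection.\<close>

lemma abs_double_le:
  assumes "c\<^sup>2 + s\<^sup>2 = (1::real)"
  shows "\<bar>c * (a\<^sup>2 - b\<^sup>2) + 2 * s * a * b\<bar> \<le> a\<^sup>2 + b\<^sup>2"
proof (rule power2_le_imp_le)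
  have "(a\<^sup>2 + b\<^sup>2)\<^sup>2 = (c * (a\<^sup>2 - b\<^sup>2) + 2 * s * a * b)\<^sup>2 + (s * (a\<^sup>2 - b\<^sup>2) - 2 * c * a * b)\<^sup>2"
    using assms by algebra
  then show "\<bar>c * (a\<^sup>2 - b\<^sup>2) + 2 * s * a * b\<bar>\<^sup>2 \<le> (a\<^sup>2 + b\<^sup>2)\<^sup>2"
    by simp
qed simp

lemma sin_double_abs: "2 * \<bar>a * b\<bar> = \<bar>sin_double a b\<bar> * (a\<^sup>2 + b\<^sup>2)"
proof (cases "a\<^sup>2 + b\<^sup>2 = 0")
  case True
  then show ?thesis by (simp add: sum_power2_eq_zero_iff)
next
  case False
  moreover have "a\<^sup>2 + b\<^sup>2 \<ge> 0" by simp
  ultimately have "a\<^sup>2 + b\<^sup>2 > 0" by linarith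
  then show ?thesis by (simp add: sin_double_def abs_mult)
qed

lemma circle_abs_le:
  assumes "c\<^sup>2 + s\<^sup>2 = (1::real)"
  shows "\<bar>c\<bar> \<le> 1" "\<bar>s\<bar> \<le> 1"
proof -
  have "c\<^sup>2 \<ge> 0" "s\<^sup>2 \<ge> 0" by simp_all
  then have "c\<^sup>2 \<le> 1" "s\<^sup>2 \<le> 1" using assms by linarith+
  then show "\<bar>c\<bar> \<le> 1" "\<bar>s\<bar> \<le> 1" using abs_le_square_iff[of c 1] abs_le_square_iff[of s 1] by auto
qed

text \<open>K minus k times a reflection is symmetric with eigenvalues K - k and K + k, both
  positive. \<open>norm_lower\<close> and \<open>dot_lower\<close> are what the smaller eigenvalue
  gives.\<close>

locale vector_step =
  fixes k K c s a b :: real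
  assumes k: "0 < k" "k < K" and circle: "c\<^sup>2 + s\<^sup>2 = 1"
begin

definition "a' = K * a - k * (c * a + s * b)"
definition "b' = K * b - k * (s * a - c * b)"

lemma norm_lower: "(K - k)\<^sup>2 * (a\<^sup>2 + b\<^sup>2) \<le> a'\<^sup>2 + b'\<^sup>2"
proof -
  have "a'\<^sup>2 + b'\<^sup>2 = (K\<^sup>2 + k\<^sup>2) * (a\<^sup>2 + b\<^sup>2) - 2 * (K * k) * (c * (a\<^sup>2 - b\<^sup>2) + 2 * s * a * b)"
    unfolding a'_def b'_def using circle by algebra
  moreover have "2 * (K * k) * (c * (a\<^sup>2 - b\<^sup>2) + 2 * s * a * b) \<le> 2 * (K * k) * (a\<^sup>2 + b\<^sup>2)"
    using abs_double_le[OF circle, of a b] k by (intro mult_left_mono) auto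
  ultimately show ?thesis by (simp add: algebra_simps power2_eq_square)
qed

lemma dot_lower: "(K - k) * (a\<^sup>2 + b\<^sup>2) \<le> a * a' + b * b'"
proof -
  have "a * a' + b * b' = K * (a\<^sup>2 + b\<^sup>2) - k * (c * (a\<^sup>2 - b\<^sup>2) + 2 * s * a * b)"
    unfolding a'_def b'_def by algebra
  moreover have "k * (c * (a\<^sup>2 - b\<^sup>2) + 2 * s * a * b) \<le> k * (a\<^sup>2 + b\<^sup>2)"
    using abs_double_le[OF circle, of a b] k by (intro mult_left_mono) auto
  ultimately show ?thesis by (simp add: algebra_simps)
qed

text \<open>Where both sines are small, the vector is close to a coordinate axis and the reflection
  is close to diagonal, so the direction is almost preserved. The cross product measures how far the
  vector turns.\<close>

lemma cross_upper: "\<bar>a * b' - b * a'\<bar> \<le> k * ((\<bar>sin_double a b\<bar> + \<bar>s\<bar>) * (a\<^sup>2 + b\<^sup>2))"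
proof -
  have "a * b' - b * a' = k * (2 * c * (a * b) - s * (a\<^sup>2 - b\<^sup>2))"
    unfolding a'_def b'_def by algebra
  moreover have "\<bar>2 * c * (a * b) - s * (a\<^sup>2 - b\<^sup>2)\<bar> \<le> (\<bar>sin_double a b\<bar> + \<bar>s\<bar>) * (a\<^sup>2 + b\<^sup>2)"
  proof -
    have "\<bar>2 * c * (a * b) - s * (a\<^sup>2 - b\<^sup>2)\<bar> \<le> \<bar>2 * c * (a * b)\<bar> + \<bar>s * (a\<^sup>2 - b\<^sup>2)\<bar>"
      by (rule abs_triangle_ineq4)
    also have "\<dots> = \<bar>c\<bar> * (2 * \<bar>a * b\<bar>) + \<bar>s\<bar> * \<bar>a\<^sup>2 - b\<^sup>2\<bar>"
      by (simp add: abs_mult)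
    also have "\<dots> \<le> 1 * (2 * \<bar>a * b\<bar>) + \<bar>s\<bar> * (a\<^sup>2 + b\<^sup>2)"
      using circle_abs_le[OF circle] by (intro add_mono mult_mono mult_right_mono mult_left_mono) (auto simp: abs_le_iff)
    finally show ?thesis by (simp add: sin_double_abs algebra_simps)
  qed
  ultimately show ?thesis using k by (simp add: abs_mult)
qed

text \<open>In a' b' the coefficient of a b is at most (K + k)^2, and the remaining terms carry the
  factor s of the off-diagonal entries. Dividing by \<open>norm_lower\<close> leaves the square of
  the condition number (K + k) / (K - k).\<close>

lemma sin_double_upper:
  assumes nz: "a\<^sup>2 + b\<^sup>2 \<noteq> 0"
  shows "\<bar>sin_double a' b'\<bar> \<le> 2 * ((K + k) / (K - k))\<^sup>2 * (\<bar>sin_double a b\<bar> + \<bar>s\<bar>)"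
proof -
  define r where "r = a\<^sup>2 + b\<^sup>2"
  have r: "r > 0" using nz unfolding r_def by (simp add: sum_power2_gt_zero_iff)
  have c1: "\<bar>c\<bar> \<le> 1" and s1: "\<bar>s\<bar> \<le> 1" using circle_abs_le[OF circle] by auto
  have kc: "\<bar>k * c\<bar> \<le> k" using c1 k by (simp add: abs_mult mult_left_le)
  have m: "0 \<le> K - k * c" "0 \<le> K + k * c" "K - k * c \<le> K + k" "K + k * c \<le> K + k" using kc k by linarith+
  have eq: "a' * b' = ((K - k * c) * (K + k * c) + k\<^sup>2 * s\<^sup>2) * (a * b)
      - k * (s * ((K - k * c) * a\<^sup>2 + (K + k * c) * b\<^sup>2))"
    unfolding a'_def b'_def by algebra
  have e0: "(K - k * c) * (K + k * c) + k\<^sup>2 * s\<^sup>2 \<ge> 0" using m by simp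
  have "k\<^sup>2 \<le> (K + k)\<^sup>2" using k by (intro power_mono) auto
  moreover have "(K - k * c) * (K + k * c) + k\<^sup>2 * s\<^sup>2 = K\<^sup>2 + k\<^sup>2 - 2 * (k\<^sup>2 * c\<^sup>2)"
    using circle by algebra
  moreover have "K\<^sup>2 + k\<^sup>2 - 2 * (k\<^sup>2 * c\<^sup>2) \<le> K\<^sup>2 + k\<^sup>2" by simp
  moreover have "K\<^sup>2 + k\<^sup>2 \<le> (K + k)\<^sup>2" using k by (simp add: power2_sum)
  ultimately have e1: "(K - k * c) * (K + k * c) + k\<^sup>2 * s\<^sup>2 \<le> (K + k)\<^sup>2" by linarith
  have e2: "(K - k * c) * a\<^sup>2 + (K + k * c) * b\<^sup>2 \<le> (K + k) * r"
    unfolding r_def distrib_left using m by (intro add_mono mult_right_mono) auto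
  have e3: "0 \<le> (K - k * c) * a\<^sup>2 + (K + k * c) * b\<^sup>2" using m by simp
  have "\<bar>a' * b'\<bar> \<le> ((K - k * c) * (K + k * c) + k\<^sup>2 * s\<^sup>2) * \<bar>a * b\<bar>
      + k * (\<bar>s\<bar> * ((K - k * c) * a\<^sup>2 + (K + k * c) * b\<^sup>2))"
    unfolding eq using k e0 e3 by (intro order_trans[OF abs_triangle_ineq4]) (simp add: abs_mult)
  also have "\<dots> \<le> (K + k)\<^sup>2 * \<bar>a * b\<bar> + (K + k) * (\<bar>s\<bar> * ((K + k) * r))"
    using k e1 e2 e3 by (intro add_mono mult_mono mult_left_mono) auto
  finally have "\<bar>a' * b'\<bar> \<le> (K + k)\<^sup>2 * \<bar>a * b\<bar> + (K + k)\<^sup>2 * (\<bar>s\<bar> * r)"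
    by (simp add: power2_eq_square algebra_simps)
  also have "\<dots> \<le> (K + k)\<^sup>2 * (2 * \<bar>a * b\<bar>) + (K + k)\<^sup>2 * (\<bar>s\<bar> * r)"
    by (intro add_mono mult_left_mono) auto
  finally have up: "\<bar>a' * b'\<bar> \<le> (K + k)\<^sup>2 * ((\<bar>sin_double a b\<bar> + \<bar>s\<bar>) * r)"
    unfolding sin_double_abs r_def[symmetric] by (simp add: algebra_simps)
  have lo: "(K - k)\<^sup>2 * r \<le> a'\<^sup>2 + b'\<^sup>2" using norm_lower unfolding r_def .
  have pos: "(K - k)\<^sup>2 * r > 0" using r k by simp
  have "\<bar>sin_double a' b'\<bar> = 2 * \<bar>a' * b'\<bar> / (a'\<^sup>2 + b'\<^sup>2)"
    unfolding sin_double_def by (simp add: abs_mult)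
  also have "\<dots> \<le> (2 * ((K + k)\<^sup>2 * ((\<bar>sin_double a b\<bar> + \<bar>s\<bar>) * r))) / ((K - k)\<^sup>2 * r)"
    using up lo pos by (intro frac_le) auto
  also have "\<dots> = 2 * ((K + k) / (K - k))\<^sup>2 * (\<bar>sin_double a b\<bar> + \<bar>s\<bar>)"
    using r k by (simp add: power_divide)
  finally show ?thesis .
qed

end

subsection \<open>The soliton train\<close>

abbreviation sech :: "real \<Rightarrow> real" where "sech y \<equiv> 1 / cosh y"

lemma sech_bounds: "0 < sech y" "sech y \<le> 1"
  using cosh_real_pos[of y] cosh_real_ge_1[of y] by (auto simp: divide_simps)

lemma sech_le_exp: "sech y \<le> 2 * exp (- \<bar>y\<bar>)"
proof -
  have "exp \<bar>y\<bar> / 2 \<le> cosh y"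
    by (cases "y \<ge> 0") (auto simp: cosh_field_def)
  then have "sech y \<le> 1 / (exp \<bar>y\<bar> / 2)"
    by (intro divide_left_mono) auto
  then show ?thesis by (simp add: exp_minus field_simps)
qed

locale soliton_train =
  fixes k :: "nat \<Rightarrow> real"
  assumes k0_pos: "0 < k 0" and k_mono: "strict_mono k"
begin

lemma k_less: "i < j \<Longrightarrow> k i < k j"
  using k_mono by (simp add: strict_mono_def)

lemma k0_le: "k 0 \<le> k j"
  using k_less[of 0 j] by (cases j) auto

lemma k_pos: "0 < k j"
  using k0_pos k0_le[of j] by linarith

text \<open>\<open>theta j\<close> vanishes on the line x = 4 (k j)^2 t, the path of a free soliton
  with parameter \<open>k j\<close>.\<close>

definition theta :: "nat \<Rightarrow> real \<Rightarrow> real \<Rightarrow> real" where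
  "theta j t x = 2 * k j * x - 8 * k j ^ 3 * t"

text \<open>\<open>(A n j, B n j)\<close> is the seed solution with parameter \<open>k j\<close>
  after n Darboux steps, where step m is driven by the vector of index m at level m. As a step
  annihilates its own driving vector, the vectors of interest at level n are those with j >=
  n.\<close>

fun A B :: "nat \<Rightarrow> nat \<Rightarrow> real \<Rightarrow> real \<Rightarrow> real" where
  "A 0 j t x = exp (theta j t x / 2)"
| "B 0 j t x = exp (- (theta j t x / 2))"
| "A (Suc n) j t x = k j * A n j t x - k n *
     (cos_double (A n n t x) (B n n t x) * A n j t x + sin_double (A n n t x) (B n n t x) * B n j t x)"
| "B (Suc n) j t x = k j * B n j t x - k n *
     (sin_double (A n n t x) (B n n t x) * A n j t x - cos_double (A n n t x) (B n n t x) * B n j t x)"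

definition C :: "nat \<Rightarrow> real \<Rightarrow> real \<Rightarrow> real" where
  "C n t x = cos_double (A n n t x) (B n n t x)"

definition S :: "nat \<Rightarrow> real \<Rightarrow> real \<Rightarrow> real" where
  "S n t x = sin_double (A n n t x) (B n n t x)"

definition q :: "nat \<Rightarrow> real \<Rightarrow> real \<Rightarrow> real" where
  "q n t x = (\<Sum>i<n. 2 * k i * S i t x)"

abbreviation G :: "nat \<Rightarrow> (real \<Rightarrow> real \<Rightarrow> real) set" where
  "G \<equiv> decay_alg C S"

lemma A_Suc: "A (Suc n) j t x = k j * A n j t x - k n * (C n t x * A n j t x + S n t x * B n j t x)"
  and B_Suc: "B (Suc n) j t x = k j * B n j t x - k n * (S n t x * A n j t x - C n t x * B n j t x)"
  by (simp_all add: C_def S_def)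

declare A.simps [simp del] B.simps [simp del]

lemma A_0: "A 0 j = (\<lambda>t x. exp (theta j t x / 2))" and B_0: "B 0 j = (\<lambda>t x. exp (- (theta j t x / 2)))"
  by (simp_all add: fun_eq_iff A.simps B.simps)

lemma A_fun: "A (Suc n) j = (\<lambda>t x. k j * A n j t x - k n * (C n t x * A n j t x + S n t x * B n j t x))"
  and B_fun: "B (Suc n) j = (\<lambda>t x. k j * B n j t x - k n * (S n t x * A n j t x - C n t x * B n j t x))"
  by (simp_all add: fun_eq_iff A_Suc B_Suc)

text \<open>The factor (k j - k n)^2 in \<open>norm_lower\<close> is positive because the parameters
  increase. The induction runs over all j at once, since the step for j also needs the driving
  vector of index n to be nonzero.\<close>

lemma nonzero:
  assumes "n \<le> j"
  shows "(A n j t x)\<^sup>2 + (B n j t x)\<^sup>2 \<noteq> 0"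
  using assms
proof (induction n arbitrary: j)
  case 0
  then show ?case by (simp add: A_0 sum_power2_eq_zero_iff)
next
  case (Suc n)
  interpret vector_step "k n" "k j" "C n t x" "S n t x" "A n j t x" "B n j t x"
  proof
    show "(C n t x)\<^sup>2 + (S n t x)\<^sup>2 = 1" unfolding C_def S_def by (intro double_circle Suc.IH) simp
  qed (use Suc.prems k_pos k_less in auto)
  have "(A n j t x)\<^sup>2 + (B n j t x)\<^sup>2 \<noteq> 0" "(A n j t x)\<^sup>2 + (B n j t x)\<^sup>2 \<ge> 0" using Suc by auto
  then have "0 < (k j - k n)\<^sup>2 * ((A n j t x)\<^sup>2 + (B n j t x)\<^sup>2)"
    using k_less[of n j] Suc.prems by (intro mult_pos_pos) (simp, linarith)
  also have "\<dots> \<le> (A (Suc n) j t x)\<^sup>2 + (B (Suc n) j t x)\<^sup>2"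
    using norm_lower unfolding a'_def b'_def A_Suc B_Suc .
  finally show ?case by (rule less_imp_neq[THEN not_sym])
qed

lemma circle: "(C n t x)\<^sup>2 + (S n t x)\<^sup>2 = 1"
  unfolding C_def S_def by (intro double_circle nonzero) simp

lemma vector_step: "n < j \<Longrightarrow> vector_step (k n) (k j) (C n t x) (S n t x)"
  using k_pos k_less circle by unfold_locales auto

lemma lax_seed: "lax_pair (k j) (\<lambda>t x. 0) (\<lambda>t x. 0) (\<lambda>t x. 0) (A 0 j) (B 0 j)"
  unfolding lax_pair_def x_deriv_def t_deriv_def A_0 B_0 theta_def
  by (auto intro!: derivative_eq_intros)

text \<open>The assertions support each other: the Lax pair for every j provides the vectors that
  drive later steps, and membership of \<open>q n\<close> and its derivatives puts the derivatives
  of the new \<open>C n\<close> and \<open>S n\<close> into the algebra.\<close>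

lemma lax_hierarchy:
  "\<exists>q1\<in>G n. \<exists>q2\<in>G n. \<exists>q3\<in>G n. mkdv_jet (q n) q1 q2 q3 \<and> q n \<in> G n \<and>
     (\<forall>j. lax_pair (k j) (q n) q1 q2 (A n j) (B n j)) \<and>
     (\<forall>i<n. has_derivs_in (C i) (G n) \<and> has_derivs_in (S i) (G n))"
proof (induction n)
  case 0
  have "mkdv_jet (\<lambda>t x. 0) (\<lambda>t x. 0) (\<lambda>t x. 0) (\<lambda>t x. 0)"
    unfolding mkdv_jet_def using x_deriv_zero t_deriv_zero by simp
  moreover have "q 0 = (\<lambda>t x. 0)" by (simp add: q_def fun_eq_iff)
  ultimately show ?case using lax_seed decay_alg.zero[of C S 0] by (metis not_less_zero)
next
  case (Suc n)
  then obtain q1 q2 q3 where q: "q1 \<in> G n" "q2 \<in> G n" "q3 \<in> G n" "q n \<in> G n"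
    and jet: "mkdv_jet (q n) q1 q2 q3" and lax: "\<And>j. lax_pair (k j) (q n) q1 q2 (A n j) (B n j)"
    and ders: "\<And>i. i < n \<Longrightarrow> has_derivs_in (C i) (G n) \<and> has_derivs_in (S i) (G n)"
    by blast
  have C_eq: "(\<lambda>t x. cos_double (A n n t x) (B n n t x)) = C n"
    and S_eq: "(\<lambda>t x. sin_double (A n n t x) (B n n t x)) = S n"
    by (simp_all add: C_def S_def fun_eq_iff)
  note angle = lax_pair_angle[OF lax nonzero[OF order.refl], unfolded C_eq S_eq, folded C_def S_def]
  interpret darboux "k n" "q n" q1 q2 q3 "C n" "S n"
    using jet circle angle by unfold_locales
  have sub: "G n \<subseteq> G (Suc n)" using decay_alg_mono[of _ C S n "Suc n"] by auto
  have mem: "q1 \<in> G (Suc n)" "q2 \<in> G (Suc n)" "q3 \<in> G (Suc n)" "q n \<in> G (Suc n)" "S n \<in> G (Suc n)"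
    using q sub by (auto intro: decay_alg.gen)
  have C_mul: "f \<in> G (Suc n) \<Longrightarrow> (\<lambda>t x. C n t x * f t x) \<in> G (Suc n)" for f
    by (rule decay_alg.mulC) simp
  have Q_eq: "Q = q (Suc n)"
    by (simp add: Q_def q_def fun_eq_iff)
  have QG: "Q \<in> G (Suc n)"
    unfolding Q_def[abs_def] by (rule decay_alg.add decay_alg.scale C_mul mem decay_alg.mul)+
  have Q1G: "Q1 \<in> G (Suc n)"
    unfolding Q1_def[abs_def] by (rule decay_alg.add decay_alg.scale C_mul mem decay_alg.mul)+
  have Q2G: "Q2 \<in> G (Suc n)"
    unfolding Q2_def[abs_def] by (rule decay_alg.add decay_alg.scale C_mul mem decay_alg.mul)+
  have Q3G: "Q3 \<in> G (Suc n)"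
    unfolding Q3_def[abs_def] by (rule decay_alg.add decay_alg.scale C_mul mem decay_alg.mul)+
  have flow: "angle_flow (k n) (q n) q1 q2 (C n) (S n) \<in> G (Suc n)"
    unfolding angle_flow_def[abs_def] by (rule decay_alg.add decay_alg.scale C_mul mem decay_alg.mul)+
  have dC: "has_derivs_in (C n) (G (Suc n))"
    by (rule has_derivs_inI[OF angle(1) angle(3)])
      (rule decay_alg.add decay_alg.scale C_mul mem flow decay_alg.mul)+
  have dS: "has_derivs_in (S n) (G (Suc n))"
    by (rule has_derivs_inI[OF angle(2) angle(4)])
      (rule decay_alg.add decay_alg.scale C_mul mem flow decay_alg.mul)+
  have "lax_pair (k j) Q Q1 Q2 (A (Suc n) j) (B (Suc n) j)" for j
    unfolding A_fun B_fun by (rule lax_Q[OF lax])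
  moreover have "has_derivs_in (C i) (G (Suc n)) \<and> has_derivs_in (S i) (G (Suc n))" if "i < Suc n" for i
    using that dC dS ders[of i] sub has_derivs_in_mono by (cases "i = n") auto
  ultimately show ?case
    using jet_Q QG Q1G Q2G Q3G unfolding Q_eq by blast
qed

lemma G_derivs: "f \<in> G n \<Longrightarrow> has_derivs_in f (G n)"
  using lax_hierarchy[of n] by (intro decay_alg_derivs) blast+

subsection \<open>Decay\<close>

text \<open>A common majorant made of bumps along the free trajectories. Its integral is the same at
  all times, which later makes the L^1 bounds uniform in time.\<close>

definition sech_sum :: "nat \<Rightarrow> real \<Rightarrow> real \<Rightarrow> real" where
  "sech_sum n t x = (\<Sum>i<n. sech (theta i t x))"

lemma sech_sum_nonneg: "0 \<le> sech_sum n t x"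
  unfolding sech_sum_def using sech_bounds(1) by (intro sum_nonneg) (auto intro: less_imp_le)

lemma sech_sum_le: "sech_sum n t x \<le> real n"
proof -
  have "sech_sum n t x \<le> (\<Sum>i<n. 1)"
    unfolding sech_sum_def using sech_bounds(2) by (intro sum_mono) auto
  then show ?thesis by simp
qed

lemma sech_sum_mono: "m \<le> n \<Longrightarrow> sech_sum m t x \<le> sech_sum n t x"
  unfolding sech_sum_def using sech_bounds(1) by (intro sum_mono2) (auto intro: less_imp_le)

lemma sin_double_seed: "sin_double (A 0 j t x) (B 0 j t x) = sech (theta j t x)"
proof -
  have "(exp (theta j t x / 2))\<^sup>2 + (exp (- (theta j t x / 2)))\<^sup>2 = 2 * cosh (theta j t x)"
    by (simp add: cosh_field_def exp_double[symmetric] power2_eq_square exp_add[symmetric])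
  moreover have "2 * exp (theta j t x / 2) * exp (- (theta j t x / 2)) = 2"
    by (simp add: exp_add[symmetric] mult.assoc)
  ultimately show ?thesis by (simp add: sin_double_def A_0 B_0)
qed

text \<open>A step enlarges the bound for index j by a multiple of |S n|, which is governed by the
  same statement with j = n; hence the induction over all j. Nothing is assumed about the distances
  between solitons, so D does not depend on t.\<close>

lemma sin_double_decay:
  "n \<le> j \<Longrightarrow> \<exists>D\<ge>0. \<forall>t x. \<bar>sin_double (A n j t x) (B n j t x)\<bar> \<le> D * (sech_sum n t x + sech (theta j t x))"
proof (induction n arbitrary: j)
  case 0
  show ?case
    by (intro exI[of _ 1]) (use sech_bounds in \<open>auto simp: sin_double_seed sech_sum_nonneg less_imp_le\<close>)
next
  case (Suc n)
  obtain D1 where D1: "D1 \<ge> 0"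
    "\<And>t x. \<bar>sin_double (A n j t x) (B n j t x)\<bar> \<le> D1 * (sech_sum n t x + sech (theta j t x))"
    using Suc.IH[of j] Suc.prems by auto
  obtain D2 where D2: "D2 \<ge> 0"
    "\<And>t x. \<bar>S n t x\<bar> \<le> D2 * (sech_sum n t x + sech (theta n t x))"
    using Suc.IH[of n] unfolding S_def by auto
  define E where "E = 2 * ((k j + k n) / (k j - k n))\<^sup>2"
  have "\<bar>sin_double (A (Suc n) j t x) (B (Suc n) j t x)\<bar>
      \<le> E * (D1 + D2) * (sech_sum (Suc n) t x + sech (theta j t x))" for t x
  proof -
    interpret vector_step "k n" "k j" "C n t x" "S n t x" "A n j t x" "B n j t x"
      using vector_step Suc.prems by simp
    let ?R = "sech_sum (Suc n) t x + sech (theta j t x)"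
    have "\<bar>sin_double (A (Suc n) j t x) (B (Suc n) j t x)\<bar> \<le> E * (\<bar>sin_double (A n j t x) (B n j t x)\<bar> + \<bar>S n t x\<bar>)"
      using sin_double_upper[OF nonzero] Suc.prems unfolding a'_def b'_def A_Suc B_Suc E_def by simp
    also have "\<dots> \<le> E * (D1 * ?R + D2 * ?R)"
    proof (intro mult_left_mono add_mono)
      show "\<bar>sin_double (A n j t x) (B n j t x)\<bar> \<le> D1 * ?R"
        using D1(2)[of t x] by (rule order_trans) (intro mult_left_mono D1 add_mono sech_sum_mono, auto)
      show "\<bar>S n t x\<bar> \<le> D2 * ?R"
        using D2(2)[of t x]
        by (rule order_trans) (intro mult_left_mono D2, use sech_bounds(1)[of "theta j t x"] in \<open>simp add: sech_sum_def\<close>)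
    qed (simp add: E_def)
    also have "\<dots> = E * (D1 + D2) * ?R" by (simp only: distrib_left distrib_right mult.assoc)
    finally show ?thesis .
  qed
  moreover have "E * (D1 + D2) \<ge> 0" using D1 D2 by (simp add: E_def)
  ultimately show ?case by blast
qed

lemma S_decay: "\<exists>D\<ge>0. \<forall>t x. \<bar>S i t x\<bar> \<le> D * sech_sum (Suc i) t x"
  using sin_double_decay[of i i] by (simp add: S_def sech_sum_def)

lemma G_decay:
  assumes "f \<in> G n"
  shows "\<exists>D\<ge>0. \<forall>t x. \<bar>f t x\<bar> \<le> D * sech_sum n t x"
  using assms
proof induction
  case zero
  then show ?case by (intro exI[of _ 0]) simp
next
  case (gen i)
  obtain D where D: "D \<ge> 0" "\<And>t x. \<bar>S i t x\<bar> \<le> D * sech_sum (Suc i) t x"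
    using S_decay by blast
  have "\<bar>S i t x\<bar> \<le> D * sech_sum n t x" for t x
    using D(2)[of t x] by (rule order_trans) (use gen D in \<open>intro mult_left_mono sech_sum_mono, auto\<close>)
  then show ?case using D by blast
next
  case (add f g)
  then obtain D1 D2 where D: "D1 \<ge> 0" "D2 \<ge> 0" "\<And>t x. \<bar>f t x\<bar> \<le> D1 * sech_sum n t x"
    "\<And>t x. \<bar>g t x\<bar> \<le> D2 * sech_sum n t x" by blast
  have "\<bar>f t x + g t x\<bar> \<le> (D1 + D2) * sech_sum n t x" for t x
    using D(3,4)[of t x] by (simp add: algebra_simps)
  then show ?case using D by (intro exI[of _ "D1 + D2"]) auto
next
  case (scale f r)
  then obtain D where D: "D \<ge> 0" "\<And>t x. \<bar>f t x\<bar> \<le> D * sech_sum n t x" by blast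
  have "\<bar>r * f t x\<bar> \<le> (\<bar>r\<bar> * D) * sech_sum n t x" for t x
    unfolding abs_mult mult.assoc by (intro mult_left_mono D) simp
  then show ?case using D by (intro exI[of _ "\<bar>r\<bar> * D"]) auto
next
  case (mulC i f)
  then obtain D where D: "D \<ge> 0" "\<And>t x. \<bar>f t x\<bar> \<le> D * sech_sum n t x" by blast
  have "\<bar>C i t x * f t x\<bar> \<le> D * sech_sum n t x" for t x
  proof -
    have "\<bar>C i t x * f t x\<bar> \<le> 1 * \<bar>f t x\<bar>"
      unfolding abs_mult using circle_abs_le[OF circle] by (intro mult_right_mono) auto
    with D(2)[of t x] show ?thesis by simp
  qed
  then show ?case using D by blast
next
  case (mul f g)
  then obtain D1 D2 where D: "D1 \<ge> 0" "D2 \<ge> 0" "\<And>t x. \<bar>f t x\<bar> \<le> D1 * sech_sum n t x"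
    "\<And>t x. \<bar>g t x\<bar> \<le> D2 * sech_sum n t x" by blast
  have "\<bar>f t x * g t x\<bar> \<le> (D1 * real n * D2) * sech_sum n t x" for t x
  proof -
    have "\<bar>f t x\<bar> \<le> D1 * real n"
      using D(3)[of t x] by (rule order_trans) (intro mult_left_mono D sech_sum_le)
    then have "\<bar>f t x * g t x\<bar> \<le> (D1 * real n) * (D2 * sech_sum n t x)"
      unfolding abs_mult using D by (intro mult_mono) auto
    then show ?thesis by (simp add: algebra_simps)
  qed
  then show ?case using D by (intro exI[of _ "D1 * real n * D2"]) auto
qed

text \<open>The slowest spatial rate 2 k 0 serves all solitons, and the motion of the centres is
  paid for by growth in t. The bound is applied at a fixed time or on bounded time intervals, where
  this growth is harmless.\<close>

lemma sech_sum_exp: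
  "sech_sum n t x \<le> 2 * real n * exp (8 * k n ^ 3 * \<bar>t\<bar>) * exp (- 2 * k 0 * \<bar>x\<bar>)"
proof -
  have "sech (theta i t x) \<le> 2 * (exp (8 * k n ^ 3 * \<bar>t\<bar>) * exp (- 2 * k 0 * \<bar>x\<bar>))" if "i < n" for i
  proof -
    have "k 0 * \<bar>x\<bar> \<le> k i * \<bar>x\<bar>" by (intro mult_right_mono k0_le) simp
    moreover have "k i ^ 3 * \<bar>t\<bar> \<le> k n ^ 3 * \<bar>t\<bar>"
      using that k_less[of i n] k_pos[of i] by (intro mult_right_mono power_mono) auto
    moreover have "\<bar>theta i t x\<bar> \<ge> \<bar>2 * k i * x\<bar> - \<bar>8 * k i ^ 3 * t\<bar>"
      unfolding theta_def by linarith
    ultimately have le: "2 * k 0 * \<bar>x\<bar> - 8 * k n ^ 3 * \<bar>t\<bar> \<le> \<bar>theta i t x\<bar>"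
      using k_pos[of i] by (simp add: abs_mult)
    have "sech (theta i t x) \<le> 2 * exp (- \<bar>theta i t x\<bar>)" by (rule sech_le_exp)
    also have "\<dots> \<le> 2 * exp (8 * k n ^ 3 * \<bar>t\<bar> + - 2 * k 0 * \<bar>x\<bar>)"
      using le by simp
    finally show ?thesis unfolding exp_add .
  qed
  then have "sech_sum n t x \<le> (\<Sum>i<n. 2 * (exp (8 * k n ^ 3 * \<bar>t\<bar>) * exp (- 2 * k 0 * \<bar>x\<bar>)))"
    unfolding sech_sum_def by (intro sum_mono) auto
  then show ?thesis by simp
qed

lemma G_exp_decay:
  assumes "f \<in> G n"
  shows "\<exists>D. \<forall>t x. \<bar>f t x\<bar> \<le> D * exp (8 * k n ^ 3 * \<bar>t\<bar>) * exp (- 2 * k 0 * \<bar>x\<bar>)"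
proof -
  obtain D where D: "D \<ge> 0" "\<And>t x. \<bar>f t x\<bar> \<le> D * sech_sum n t x" using G_decay[OF assms] by blast
  have "\<bar>f t x\<bar> \<le> (D * (2 * real n)) * exp (8 * k n ^ 3 * \<bar>t\<bar>) * exp (- 2 * k 0 * \<bar>x\<bar>)" for t x
  proof -
    have "\<bar>f t x\<bar> \<le> D * (2 * real n * exp (8 * k n ^ 3 * \<bar>t\<bar>) * exp (- 2 * k 0 * \<bar>x\<bar>))"
      using D(2)[of t x] by (rule order_trans) (intro mult_left_mono D sech_sum_exp)
    then show ?thesis by (simp add: algebra_simps)
  qed
  then show ?thesis by blast
qed

subsection \<open>Asymptotic phase\<close>

text \<open>Up to sign, \<open>k j * sin_double (A n j) (B n j) + q n\<close> is the \<open>x\<close>-derivative of the polar angle of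
  \<open>(A n j, B n j)\<close>. Each Darboux step changes this angle by \<open>arctan (cr / dt)\<close>, where \<open>dt > 0\<close>.\<close>

lemma phase_remainder:
  "n \<le> j \<Longrightarrow> \<exists>\<rho> D. D \<ge> 0 \<and> (\<forall>t x. \<bar>\<rho> t x\<bar> \<le> D * (sech_sum n t x + sech (theta j t x))) \<and>
     x_deriv \<rho> (\<lambda>t x. k j / cosh (theta j t x) - k j * sin_double (A n j t x) (B n j t x) - q n t x)"
proof (induction n)
  case 0
  have "x_deriv (\<lambda>t x. 0) (\<lambda>t x. k j / cosh (theta j t x) - k j * sin_double (A 0 j t x) (B 0 j t x) - q 0 t x)"
    unfolding sin_double_seed using x_deriv_zero by (simp add: q_def)
  then show ?case by (intro exI[of _ "\<lambda>t x. 0"] exI[of _ 0]) simp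
next
  case (Suc n)
  then obtain \<rho> D where D: "D \<ge> 0"
    and \<rho>: "\<And>t x. \<bar>\<rho> t x\<bar> \<le> D * (sech_sum n t x + sech (theta j t x))"
    and \<rho>x: "x_deriv \<rho> (\<lambda>t x. k j / cosh (theta j t x) - k j * sin_double (A n j t x) (B n j t x) - q n t x)"
    by auto
  obtain D1 where D1: "D1 \<ge> 0"
    "\<And>t x. \<bar>sin_double (A n j t x) (B n j t x)\<bar> \<le> D1 * (sech_sum n t x + sech (theta j t x))"
    using sin_double_decay[of n j] Suc.prems by auto
  obtain D2 where D2: "D2 \<ge> 0" "\<And>t x. \<bar>S n t x\<bar> \<le> D2 * sech_sum (Suc n) t x"
    using S_decay by blast
  \<comment> \<open>Cross and dot product of the vector before and after the step: cr / dt is the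
    tangent of the turning angle. As dt > 0, \<open>arctan\<close> recovers that angle without a
    choice of branch.\<close>
  define cr where "cr t x = A n j t x * B (Suc n) j t x - B n j t x * A (Suc n) j t x" for t x
  define dt where "dt t x = A n j t x * A (Suc n) j t x + B n j t x * B (Suc n) j t x" for t x
  define E where "E = k n / (k j - k n)"
  have kk: "k n < k j" "0 < k n" using Suc.prems k_less k_pos by auto
  then have E: "E \<ge> 0" by (simp add: E_def)
  have dt_lo: "(k j - k n) * ((A n j t x)\<^sup>2 + (B n j t x)\<^sup>2) \<le> dt t x"
    and cr_up: "\<bar>cr t x\<bar> \<le> k n * ((\<bar>sin_double (A n j t x) (B n j t x)\<bar> + \<bar>S n t x\<bar>) * ((A n j t x)\<^sup>2 + (B n j t x)\<^sup>2))"
    for t x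
  proof -
    interpret vector_step "k n" "k j" "C n t x" "S n t x" "A n j t x" "B n j t x"
      using vector_step Suc.prems by simp
    show "(k j - k n) * ((A n j t x)\<^sup>2 + (B n j t x)\<^sup>2) \<le> dt t x"
      using dot_lower unfolding a'_def b'_def A_Suc B_Suc dt_def .
    show "\<bar>cr t x\<bar> \<le> k n * ((\<bar>sin_double (A n j t x) (B n j t x)\<bar> + \<bar>S n t x\<bar>) * ((A n j t x)\<^sup>2 + (B n j t x)\<^sup>2))"
      using cross_upper unfolding a'_def b'_def A_Suc B_Suc cr_def .
  qed
  have r: "(A n j t x)\<^sup>2 + (B n j t x)\<^sup>2 > 0" for t x
    using nonzero[of n j t x] Suc.prems by (simp add: sum_power2_gt_zero_iff sum_power2_eq_zero_iff)
  have dt_pos: "dt t x > 0" for t x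
    using dt_lo[of t x] mult_pos_pos[OF _ r, of "k j - k n" t x] kk by linarith
  define \<rho>' where "\<rho>' t x = \<rho> t x + arctan (cr t x / dt t x)" for t x
  have bound: "\<bar>\<rho>' t x\<bar> \<le> (D + E * (D1 + D2)) * (sech_sum (Suc n) t x + sech (theta j t x))" for t x
  proof -
    let ?R = "sech_sum (Suc n) t x + sech (theta j t x)"
    have R1: "sech_sum n t x + sech (theta j t x) \<le> ?R" by (simp add: sech_sum_mono)
    have R2: "sech_sum (Suc n) t x \<le> ?R" using sech_bounds(1)[of "theta j t x"] by linarith
    have "\<bar>arctan (cr t x / dt t x)\<bar> \<le> \<bar>cr t x / dt t x\<bar>" by (rule abs_arctan_le)
    also have "\<dots> = \<bar>cr t x\<bar> / dt t x" using dt_pos[of t x] by simp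
    also have "\<dots> \<le> (k n * ((\<bar>sin_double (A n j t x) (B n j t x)\<bar> + \<bar>S n t x\<bar>) * ((A n j t x)\<^sup>2 + (B n j t x)\<^sup>2)))
        / ((k j - k n) * ((A n j t x)\<^sup>2 + (B n j t x)\<^sup>2))"
      using cr_up[of t x] dt_lo[of t x] kk r[of t x] by (intro frac_le) auto
    also have "\<dots> = E * (\<bar>sin_double (A n j t x) (B n j t x)\<bar> + \<bar>S n t x\<bar>)"
      unfolding E_def using kk less_imp_neq[OF r[of t x]] by (simp del: sum_power2_eq_zero_iff)
    also have "\<dots> \<le> E * (D1 * ?R + D2 * ?R)"
    proof (intro mult_left_mono add_mono E)
      show "\<bar>sin_double (A n j t x) (B n j t x)\<bar> \<le> D1 * ?R"
        using D1(2)[of t x] mult_left_mono[OF R1 D1(1)] by linarith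
      show "\<bar>S n t x\<bar> \<le> D2 * ?R" using D2(2)[of t x] mult_left_mono[OF R2 D2(1)] by linarith
    qed
    finally have a: "\<bar>arctan (cr t x / dt t x)\<bar> \<le> E * (D1 * ?R + D2 * ?R)" .
    have "\<bar>\<rho> t x\<bar> \<le> D * ?R" using \<rho>[of t x] mult_left_mono[OF R1 D] by linarith
    moreover have "(D + E * (D1 + D2)) * ?R = D * ?R + E * (D1 * ?R + D2 * ?R)"
      by (simp only: distrib_left distrib_right mult.assoc)
    ultimately show ?thesis using a abs_triangle_ineq[of "\<rho> t x" "arctan (cr t x / dt t x)"]
      unfolding \<rho>'_def by linarith
  qed
  obtain q1 q2 where lax: "lax_pair (k j) (q n) q1 q2 (A n j) (B n j)" using lax_hierarchy[of n] by blast
  obtain p1 p2 where lax': "lax_pair (k j) (q (Suc n)) p1 p2 (A (Suc n) j) (B (Suc n) j)"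
    using lax_hierarchy[of "Suc n"] by blast
  have "x_deriv \<rho>' (\<lambda>t x. k j / cosh (theta j t x) - k j * sin_double (A (Suc n) j t x) (B (Suc n) j t x) - q (Suc n) t x)"
    unfolding x_deriv_def
  proof (intro allI)
    fix t x
    let ?a = "A n j t x" and ?b = "B n j t x" and ?c = "A (Suc n) j t x" and ?d = "B (Suc n) j t x"
    let ?q = "q n t x" and ?p = "q (Suc n) t x"
    have ders: "(A n j t has_real_derivative k j * ?a + ?q * ?b) (at x)"
      "(B n j t has_real_derivative - ?q * ?a - k j * ?b) (at x)"
      "(A (Suc n) j t has_real_derivative k j * ?c + ?p * ?d) (at x)"
      "(B (Suc n) j t has_real_derivative - ?p * ?c - k j * ?d) (at x)"
      using lax lax' unfolding lax_pair_def x_deriv_def by auto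
    have n1: "?a\<^sup>2 + ?b\<^sup>2 \<noteq> 0" and n2: "?c\<^sup>2 + ?d\<^sup>2 \<noteq> 0"
      using nonzero[of n j t x] nonzero[of "Suc n" j t x] Suc.prems by auto
    have dt0: "dt t x \<noteq> 0" using dt_pos[of t x] by simp
    have lagrange: "(dt t x)\<^sup>2 + (cr t x)\<^sup>2 = (?a\<^sup>2 + ?b\<^sup>2) * (?c\<^sup>2 + ?d\<^sup>2)"
      unfolding dt_def cr_def by algebra
    define cr' where "cr' = (k j * ?a + ?q * ?b) * ?d + ?a * (- ?p * ?c - k j * ?d)
        - ((- ?q * ?a - k j * ?b) * ?c + ?b * (k j * ?c + ?p * ?d))"
    define dt' where "dt' = (k j * ?a + ?q * ?b) * ?c + ?a * (k j * ?c + ?p * ?d)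
        + ((- ?q * ?a - k j * ?b) * ?d + ?b * (- ?p * ?c - k j * ?d))"
    have dcr: "(cr t has_real_derivative cr') (at x)"
      unfolding cr_def cr'_def by (rule DERIV_cong, (rule derivative_intros ders)+) (simp add: algebra_simps)
    have ddt: "(dt t has_real_derivative dt') (at x)"
      unfolding dt_def dt'_def by (rule DERIV_cong, (rule derivative_intros ders)+) (simp add: algebra_simps)
    have "((\<lambda>x. arctan (cr t x / dt t x)) has_real_derivative
        inverse (1 + (cr t x / dt t x)\<^sup>2) * ((cr' * dt t x - cr t x * dt') / (dt t x * dt t x))) (at x)"
      by (rule DERIV_chain2[OF DERIV_arctan DERIV_divide[OF dcr ddt dt0]])
    moreover have "inverse (1 + (cr t x / dt t x)\<^sup>2) * ((cr' * dt t x - cr t x * dt') / (dt t x * dt t x))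
        = (cr' * dt t x - cr t x * dt') / ((dt t x)\<^sup>2 + (cr t x)\<^sup>2)"
    proof -
      have "1 + (cr t x / dt t x)\<^sup>2 = ((dt t x)\<^sup>2 + (cr t x)\<^sup>2) / (dt t x)\<^sup>2"
        using dt0 by (simp add: power_divide add_divide_distrib)
      then show ?thesis using dt0 by (simp add: power2_eq_square)
    qed
    moreover have "(cr' * dt t x - cr t x * dt') / ((dt t x)\<^sup>2 + (cr t x)\<^sup>2)
        = (k j * sin_double ?a ?b + ?q) - (k j * sin_double ?c ?d + ?p)"
    proof -
      \<comment> \<open>The turning angle changes at the angular velocity after the step minus the
        one before it. Each velocity is minus the sum of \<open>k j * sin_double\<close> and the
        potential.\<close>
      have "cr' * dt t x - cr t x * dt' = (2 * k j * ?a * ?b + ?q * (?a\<^sup>2 + ?b\<^sup>2)) * (?c\<^sup>2 + ?d\<^sup>2)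
          - (2 * k j * ?c * ?d + ?p * (?c\<^sup>2 + ?d\<^sup>2)) * (?a\<^sup>2 + ?b\<^sup>2)"
        unfolding cr'_def dt'_def cr_def dt_def by algebra
      then show ?thesis unfolding lagrange sin_double_def using n1 n2
        by (simp add: divide_simps) (simp add: algebra_simps)
    qed
    ultimately have d: "((\<lambda>x. arctan (cr t x / dt t x)) has_real_derivative
        (k j * sin_double ?a ?b + ?q) - (k j * sin_double ?c ?d + ?p)) (at x)" by simp
    have "(\<rho> t has_real_derivative k j / cosh (theta j t x) - k j * sin_double ?a ?b - ?q) (at x)"
      using \<rho>x unfolding x_deriv_def by blast
    from DERIV_add[OF this d] show "(\<rho>' t has_real_derivative k j / cosh (theta j t x) - k j * sin_double ?c ?d - ?p) (at x)"
      unfolding \<rho>'_def by (rule DERIV_cong) simp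
  qed
  moreover have "D + E * (D1 + D2) \<ge> 0" using D E D1 D2 by simp
  ultimately show ?case using bound by blast
qed

text \<open>By \<open>phase_remainder\<close> with j = n, the term \<open>k n * S n\<close> equals
  \<open>k n * sech (theta n)\<close> minus \<open>q n\<close> up to a derivative. Hence
  \<open>q (Suc n) = q n + 2 * k n * S n\<close> is a new positive soliton minus \<open>q n\<close>,
  again up to a derivative. Each step reverses the signs of all earlier solitons, which is the
  origin of the alternation.\<close>

lemma potential_remainder:
  "\<exists>R D. D \<ge> 0 \<and> (\<forall>t x. \<bar>R t x\<bar> \<le> D * sech_sum n t x) \<and>
     x_deriv R (\<lambda>t x. q n t x - (\<Sum>i<n. (-1) ^ (n - 1 - i) * (2 * k i / cosh (theta i t x))))"
proof (induction n)
  case 0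
  show ?case
    by (intro exI[of _ "\<lambda>t x. 0"] exI[of _ 0]) (simp add: q_def x_deriv_zero)
next
  case (Suc n)
  then obtain R D where D: "D \<ge> 0" and R: "\<And>t x. \<bar>R t x\<bar> \<le> D * sech_sum n t x"
    and Rx: "x_deriv R (\<lambda>t x. q n t x - (\<Sum>i<n. (-1) ^ (n - 1 - i) * (2 * k i / cosh (theta i t x))))"
    by blast
  obtain \<rho> D1 where D1: "D1 \<ge> 0" and \<rho>: "\<And>t x. \<bar>\<rho> t x\<bar> \<le> D1 * sech_sum (Suc n) t x"
    and \<rho>x: "x_deriv \<rho> (\<lambda>t x. k n / cosh (theta n t x) - k n * S n t x - q n t x)"
    using phase_remainder[of n n] unfolding S_def sech_sum_def by auto
  have "\<bar>- R t x - 2 * \<rho> t x\<bar> \<le> (D + 2 * D1) * sech_sum (Suc n) t x" for t x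
  proof -
    have "D * sech_sum n t x \<le> D * sech_sum (Suc n) t x" by (intro mult_left_mono D sech_sum_mono) simp
    with R[of t x] \<rho>[of t x] show ?thesis unfolding abs_le_iff by (simp add: algebra_simps)
  qed
  moreover have "x_deriv (\<lambda>t x. - R t x - 2 * \<rho> t x)
     (\<lambda>t x. q (Suc n) t x - (\<Sum>i<Suc n. (-1) ^ (Suc n - 1 - i) * (2 * k i / cosh (theta i t x))))"
    unfolding x_deriv_def
  proof (intro allI)
    fix t x
    have s: "(\<Sum>i<n. (-1) ^ (n - i) * (2 * k i / cosh (theta i t x)))
        = - (\<Sum>i<n. (-1) ^ (n - 1 - i) * (2 * k i / cosh (theta i t x)))"
      unfolding sum_negf[symmetric]
    proof (intro sum.cong refl)
      fix i assume "i \<in> {..<n}"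
      then have "n - i = Suc (n - 1 - i)" by auto
      then show "(-1) ^ (n - i) * (2 * k i / cosh (theta i t x)) = - ((-1) ^ (n - 1 - i) * (2 * k i / cosh (theta i t x)))"
        by simp
    qed
    have h: "(R t has_real_derivative q n t x - (\<Sum>i<n. (-1) ^ (n - 1 - i) * (2 * k i / cosh (theta i t x)))) (at x)"
      "(\<rho> t has_real_derivative k n / cosh (theta n t x) - k n * S n t x - q n t x) (at x)"
      using Rx \<rho>x unfolding x_deriv_def by blast+
    have "((\<lambda>x. - R t x - 2 * \<rho> t x) has_real_derivative
       - (q n t x - (\<Sum>i<n. (-1) ^ (n - 1 - i) * (2 * k i / cosh (theta i t x))))
       - 2 * (k n / cosh (theta n t x) - k n * S n t x - q n t x)) (at x)"
      by (rule DERIV_diff[OF DERIV_minus[OF h(1)] DERIV_cmult[OF h(2)]])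
    then show "((\<lambda>x. - R t x - 2 * \<rho> t x) has_real_derivative
      q (Suc n) t x - (\<Sum>i<Suc n. (-1) ^ (Suc n - 1 - i) * (2 * k i / cosh (theta i t x)))) (at x)"
      by (rule DERIV_cong) (simp add: s[simplified] q_def)
  qed
  moreover have "D + 2 * D1 \<ge> 0" using D D1 by simp
  ultimately show ?case
    by (intro exI[of _ "\<lambda>t x. - R t x - 2 * \<rho> t x"] exI[of _ "D + 2 * D1"] conjI allI)
qed

end

subsection \<open>Schwartz solutions\<close>

text \<open>Each power of |x| is absorbed by half of the exponential rate, through y \<le> exp
  y.\<close>

lemma power_exp_bounded:
  assumes "a > 0"
  shows "\<exists>M\<ge>0. \<forall>x::real. \<bar>x\<bar> ^ j * exp (- a * \<bar>x\<bar>) \<le> M"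
  using assms
proof (induction j arbitrary: a)
  case 0
  then show ?case by (intro exI[of _ 1]) auto
next
  case (Suc j)
  obtain M where M: "M \<ge> 0" "\<And>x::real. \<bar>x\<bar> ^ j * exp (- (a/2) * \<bar>x\<bar>) \<le> M"
    using Suc.IH[of "a/2"] Suc.prems by auto
  have "\<bar>x\<bar> ^ Suc j * exp (- a * \<bar>x\<bar>) \<le> 2 / a * M" for x :: real
  proof -
    have "a / 2 * \<bar>x\<bar> \<le> exp (a / 2 * \<bar>x\<bar>)" using exp_ge_add_one_self[of "a / 2 * \<bar>x\<bar>"] by linarith
    then have "\<bar>x\<bar> * exp (- (a/2) * \<bar>x\<bar>) \<le> 2 / a"
      using Suc.prems by (simp add: exp_minus field_simps)
    then have "(\<bar>x\<bar> * exp (- (a/2) * \<bar>x\<bar>)) * (\<bar>x\<bar> ^ j * exp (- (a/2) * \<bar>x\<bar>)) \<le> 2 / a * M"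
      using M Suc.prems by (intro mult_mono) auto
    moreover have "exp (- a * \<bar>x\<bar>) = exp (- (a/2) * \<bar>x\<bar>) * exp (- (a/2) * \<bar>x\<bar>)"
      by (simp add: exp_add[symmetric])
    ultimately show ?thesis by (simp add: mult_ac)
  qed
  moreover have "2 / a * M \<ge> 0" using M Suc.prems by simp
  ultimately show ?case by blast
qed

definition uniform_exp_decay :: "(real \<Rightarrow> real \<Rightarrow> real) \<Rightarrow> bool" where
  "uniform_exp_decay f \<longleftrightarrow> (\<exists>D K a. a > 0 \<and> (\<forall>t x. \<bar>f t x\<bar> \<le> D * exp (K * \<bar>t\<bar>) * exp (- a * \<bar>x\<bar>)))"

lemma x_deriv_imp_deriv: "x_deriv f g \<Longrightarrow> deriv (f t) = g t"
  unfolding x_deriv_def by (auto intro!: DERIV_imp_deriv)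

text \<open>Closure under x-derivatives gives every spatial derivative the decay of the class.
  Closure under t-derivatives bounds the time derivative of each weighted spatial derivative near
  t0, so by the mean value inequality every seminorm of q t - q t0 is O(|t - t0|).\<close>

lemma schwartz_solution_criterion:
  assumes ders: "\<And>f. f \<in> G \<Longrightarrow> has_derivs_in f G"
    and decay: "\<And>f. f \<in> G \<Longrightarrow> uniform_exp_decay f"
    and q: "q \<in> G" and jet: "mkdv_jet q q1 q2 q3"
  shows "schwartz_solution_mkdv q"
proof -
  \<comment> \<open>The clause on differences is carried along because \<open>deriv\<close> is
    additive only where both functions are differentiable.\<close>
  have iter: "\<exists>g\<in>G. (\<forall>t. (deriv ^^ m) (q t) = g t) \<and>
      (\<forall>t t0. (deriv ^^ m) (\<lambda>x. q t x - q t0 x) = (\<lambda>x. g t x - g t0 x))" for m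
  proof (induction m)
    case 0
    then show ?case using q by auto
  next
    case (Suc m)
    then obtain g where g: "g \<in> G" "\<And>t. (deriv ^^ m) (q t) = g t"
      "\<And>t t0. (deriv ^^ m) (\<lambda>x. q t x - q t0 x) = (\<lambda>x. g t x - g t0 x)" by blast
    obtain h where h: "h \<in> G" "x_deriv g h" using ders[OF g(1)] unfolding has_derivs_in_def by blast
    have "deriv (\<lambda>x. g t x - g t0 x) = (\<lambda>x. h t x - h t0 x)" for t t0
      using h(2) unfolding x_deriv_def by (intro ext DERIV_imp_deriv DERIV_diff) auto
    then show ?case using g h x_deriv_imp_deriv[OF h(2)] by (intro bexI[of _ h]) auto
  qed
  have weighted: "\<exists>M\<ge>0. \<forall>t x. \<bar>t\<bar> \<le> T \<longrightarrow> \<bar>x ^ j * g t x\<bar> \<le> M" if g: "g \<in> G" for g j T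
  proof -
    obtain D K a where a: "a > 0" and D: "\<And>t x. \<bar>g t x\<bar> \<le> D * exp (K * \<bar>t\<bar>) * exp (- a * \<bar>x\<bar>)"
      using decay[OF g] unfolding uniform_exp_decay_def by blast
    obtain M where M: "M \<ge> 0" "\<And>x::real. \<bar>x\<bar> ^ j * exp (- a * \<bar>x\<bar>) \<le> M"
      using power_exp_bounded[OF a] by blast
    have D0: "D \<ge> 0" using D[of 0 0] by simp
    have "\<bar>x ^ j * g t x\<bar> \<le> D * exp (\<bar>K\<bar> * T) * M" if t: "\<bar>t\<bar> \<le> T" for t x
    proof -
      have "K * \<bar>t\<bar> \<le> \<bar>K\<bar> * T" using t by (intro mult_mono) auto
      then have "D * exp (K * \<bar>t\<bar>) \<le> D * exp (\<bar>K\<bar> * T)" using D0 by (intro mult_left_mono) auto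
      then have "\<bar>g t x\<bar> \<le> D * exp (\<bar>K\<bar> * T) * exp (- a * \<bar>x\<bar>)"
        by (intro order_trans[OF D] mult_right_mono) auto
      then have "\<bar>x ^ j * g t x\<bar> \<le> \<bar>x\<bar> ^ j * (D * exp (\<bar>K\<bar> * T) * exp (- a * \<bar>x\<bar>))"
        unfolding abs_mult power_abs by (intro mult_left_mono) auto
      also have "\<dots> = D * exp (\<bar>K\<bar> * T) * (\<bar>x\<bar> ^ j * exp (- a * \<bar>x\<bar>))" by (simp only: mult_ac)
      also have "\<dots> \<le> D * exp (\<bar>K\<bar> * T) * M" using D0 by (intro mult_left_mono M) auto
      finally show ?thesis .
    qed
    moreover have "D * exp (\<bar>K\<bar> * T) * M \<ge> 0" using D0 M by simp
    ultimately show ?thesis by blast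
  qed
  have schwartz: "schwartz (q t)" for t
    unfolding schwartz_def
  proof (intro conjI allI)
    fix m x
    obtain g where g: "g \<in> G" "\<And>t. (deriv ^^ m) (q t) = g t" using iter[of m] by blast
    obtain h where "x_deriv g h" using ders[OF g(1)] unfolding has_derivs_in_def by blast
    then show "(deriv ^^ m) (q t) differentiable at x"
      unfolding g(2) x_deriv_def real_differentiable_def by blast
  next
    fix j m
    obtain g where g: "g \<in> G" "\<And>t. (deriv ^^ m) (q t) = g t" using iter[of m] by blast
    obtain M where "\<And>s x. \<bar>s\<bar> \<le> \<bar>t\<bar> \<Longrightarrow> \<bar>x ^ j * g s x\<bar> \<le> M" using weighted[OF g(1)] by blast
    then show "bounded (range (\<lambda>x. x ^ j * (deriv ^^ m) (q t) x))"
      unfolding g(2) bounded_iff by auto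
  qed
  have cont: "((\<lambda>t. schwartz_seminorm j m (\<lambda>x. q t x - q t0 x)) \<longlongrightarrow> 0) (at t0)" for t0 j m
  proof -
    obtain g where g: "g \<in> G" "\<And>t. (deriv ^^ m) (\<lambda>x. q t x - q t0 x) = (\<lambda>x. g t x - g t0 x)"
      using iter[of m] by blast
    obtain h where h: "h \<in> G" "t_deriv g h" using ders[OF g(1)] unfolding has_derivs_in_def by blast
    obtain M where M: "M \<ge> 0" "\<And>t x. \<bar>t\<bar> \<le> \<bar>t0\<bar> + 1 \<Longrightarrow> \<bar>x ^ j * h t x\<bar> \<le> M" using weighted[OF h(1)] by blast
    have diff: "\<bar>x ^ j * (g t x - g t0 x)\<bar> \<le> M * \<bar>t - t0\<bar>" if "\<bar>t - t0\<bar> \<le> 1" for t x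
    proof -
      have "norm (x ^ j * g t x - x ^ j * g t0 x) \<le> M * norm (t - t0)"
      proof (rule field_differentiable_bound[of "cball t0 1"])
        fix s assume s: "s \<in> cball t0 1"
        have "((\<lambda>s. g s x) has_real_derivative h s x) (at s)"
          using h(2) unfolding t_deriv_def by blast
        then show "((\<lambda>s. x ^ j * g s x) has_real_derivative x ^ j * h s x) (at s within cball t0 1)"
          by (rule has_field_derivative_at_within[OF DERIV_cmult])
        show "norm (x ^ j * h s x) \<le> M"
          unfolding real_norm_def using s by (intro M) (auto simp: dist_real_def)
      qed (use that in \<open>auto simp: dist_real_def\<close>)
      then show ?thesis by (simp add: right_diff_distrib)
    qed
    have bound: "norm (schwartz_seminorm j m (\<lambda>x. q t x - q t0 x)) \<le> M * \<bar>t - t0\<bar>" if t: "\<bar>t - t0\<bar> \<le> 1" for t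
    proof -
      let ?S = "\<lambda>x. \<bar>x ^ j * (g t x - g t0 x)\<bar>"
      \<comment> \<open>A real supremum is meaningful only over a set bounded above. Its member at x
        = 0 then shows that it is nonnegative.\<close>
      have "bdd_above (range ?S)" by (rule bdd_aboveI2) (rule diff[OF t])
      then have "?S 0 \<le> (SUP x. ?S x)"
        by (rule cSUP_upper[OF UNIV_I])
      then have "0 \<le> (SUP x. ?S x)"
        by (rule order_trans[OF abs_ge_zero])
      moreover have "(SUP x. ?S x) \<le> M * \<bar>t - t0\<bar>" using diff[OF t] by (intro cSUP_least) auto
      ultimately show ?thesis unfolding schwartz_seminorm_def g(2) by simp
    qed
    have "\<forall>\<^sub>F t in at t0. norm (schwartz_seminorm j m (\<lambda>x. q t x - q t0 x)) \<le> M * \<bar>t - t0\<bar>"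
      unfolding eventually_at by (intro exI[of _ 1]) (use bound in \<open>auto simp: dist_real_def\<close>)
    moreover have "((\<lambda>t. M * \<bar>t - t0\<bar>) \<longlongrightarrow> 0) (at t0)"
      by (auto intro!: tendsto_eq_intros)
    ultimately show ?thesis by (rule Lim_null_comparison)
  qed
  have "((\<lambda>s. q s x) has_real_derivative (- (deriv ^^ 3) (q t) x - 2 * deriv (\<lambda>y. (q t y) ^ 3) x)) (at t)" for t x
  proof -
    have xd: "x_deriv q q1" "x_deriv q1 q2" "x_deriv q2 q3"
      and td: "((\<lambda>s. q s x) has_real_derivative - q3 t x - 6 * (q t x)\<^sup>2 * q1 t x) (at t)"
      using jet unfolding mkdv_jet_def t_deriv_def by auto
    have "(deriv ^^ 3) (q t) = q3 t"
      using xd by (simp add: numeral_3_eq_3 x_deriv_imp_deriv)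
    moreover have "deriv (\<lambda>y. (q t y) ^ 3) x = 3 * (q t x)\<^sup>2 * q1 t x"
      using xd(1) unfolding x_deriv_def by (intro DERIV_imp_deriv) (auto intro!: derivative_eq_intros)
    ultimately show ?thesis using td by (simp add: mult.assoc)
  qed
  then show ?thesis
    unfolding schwartz_solution_mkdv_def continuous_in_schwartz_def using schwartz cont by blast
qed

section \<open>Rescaled multisolitons as Schwartz solutions\<close>

context soliton_train
begin

lemma G_uniform_exp_decay: "f \<in> G n \<Longrightarrow> uniform_exp_decay f"
  using G_exp_decay[of f n] k0_pos unfolding uniform_exp_decay_def
  by (metis mult_minus_left mult_pos_pos zero_less_numeral)

lemma schwartz_scaled:
  assumes l: "l \<noteq> 0"
  shows "schwartz_solution_mkdv (\<lambda>t x. l * q n (l ^ 3 * t) (l * x))"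
proof -
  define sc where "sc c f = (\<lambda>t x. c * f (l ^ 3 * t) (l * x))" for c and f :: "real \<Rightarrow> real \<Rightarrow> real"
  obtain q1 q2 q3 where jet: "mkdv_jet (q n) q1 q2 q3" and qG: "q n \<in> G n"
    using lax_hierarchy[of n] by blast
  have scx: "x_deriv (sc c f) (sc (c * l) g)" if "x_deriv f g" for c f g
    unfolding x_deriv_def sc_def
  proof (intro allI)
    fix t x
    have "((\<lambda>y. f (l ^ 3 * t) (l * y)) has_real_derivative g (l ^ 3 * t) (l * x) * l) (at x)"
      using that unfolding x_deriv_def
      by (intro DERIV_chain2[of "f (l ^ 3 * t)" _ "\<lambda>y. l * y"]) (auto intro!: derivative_eq_intros)
    then show "((\<lambda>y. c * f (l ^ 3 * t) (l * y)) has_real_derivative c * l * g (l ^ 3 * t) (l * x)) (at x)"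
      by (rule DERIV_cong[OF DERIV_cmult]) simp
  qed
  have sct: "t_deriv (sc c f) (sc (c * l ^ 3) g)" if "t_deriv f g" for c f g
    unfolding t_deriv_def sc_def
  proof (intro allI)
    fix t x
    have "((\<lambda>s. f (l ^ 3 * s) (l * x)) has_real_derivative g (l ^ 3 * t) (l * x) * l ^ 3) (at t)"
      using that unfolding t_deriv_def
      by (intro DERIV_chain2[of "\<lambda>s. f s (l * x)" _ "\<lambda>s. l ^ 3 * s"]) (auto intro!: derivative_eq_intros)
    then show "((\<lambda>s. c * f (l ^ 3 * s) (l * x)) has_real_derivative c * l ^ 3 * g (l ^ 3 * t) (l * x)) (at t)"
      by (rule DERIV_cong[OF DERIV_cmult]) simp
  qed
  define G' where "G' = {sc c f | c f. f \<in> G n}"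
  have "schwartz_solution_mkdv (sc l (q n))"
  proof (rule schwartz_solution_criterion)
    fix f assume "f \<in> G'"
    then obtain c g where f: "f = sc c g" and g: "g \<in> G n" unfolding G'_def by blast
    obtain gx gt where "x_deriv g gx" "t_deriv g gt" "gx \<in> G n" "gt \<in> G n"
      using G_derivs[OF g] unfolding has_derivs_in_def by blast
    then show "has_derivs_in f G'"
      unfolding f G'_def by (intro has_derivs_inI[OF scx sct]) auto
    obtain D K a where a: "a > 0" and D: "\<And>t x. \<bar>g t x\<bar> \<le> D * exp (K * \<bar>t\<bar>) * exp (- a * \<bar>x\<bar>)"
      using G_uniform_exp_decay[OF g] unfolding uniform_exp_decay_def by blast
    have "\<bar>f t x\<bar> \<le> (\<bar>c\<bar> * D) * exp ((K * \<bar>l ^ 3\<bar>) * \<bar>t\<bar>) * exp (- (a * \<bar>l\<bar>) * \<bar>x\<bar>)" for t x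
    proof -
      have "\<bar>f t x\<bar> \<le> \<bar>c\<bar> * (D * exp (K * \<bar>l ^ 3 * t\<bar>) * exp (- a * \<bar>l * x\<bar>))"
        unfolding f sc_def abs_mult[of c] by (intro mult_left_mono D) simp
      then show ?thesis by (simp add: abs_mult mult_ac)
    qed
    moreover have "a * \<bar>l\<bar> > 0" using a l by simp
    ultimately show "uniform_exp_decay f" unfolding uniform_exp_decay_def by blast
  next
    show "sc l (q n) \<in> G'" using qG unfolding G'_def by blast
    have td: "t_deriv (q n) (\<lambda>t x. - q3 t x - 6 * (q n t x)\<^sup>2 * q1 t x)"
      using jet unfolding mkdv_jet_def by blast
    \<comment> \<open>The scaling symmetry of the equation: q3 and q^2 q1 both acquire the factor
      l^4.\<close>
    have "sc (l * l ^ 3) (\<lambda>t x. - q3 t x - 6 * (q n t x)\<^sup>2 * q1 t x)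
      = (\<lambda>t x. - sc (l * l * l * l) q3 t x - 6 * (sc l (q n) t x)\<^sup>2 * sc (l * l) q1 t x)"
      unfolding sc_def by (simp add: fun_eq_iff power2_eq_square power3_eq_cube algebra_simps)
    then show "mkdv_jet (sc l (q n)) (sc (l * l) q1) (sc (l * l * l) q2) (sc (l * l * l * l) q3)"
      using sct[OF td, of l] jet scx unfolding mkdv_jet_def by auto
  qed
  then show ?thesis unfolding sc_def .
qed

end

subsection \<open>Integrability\<close>

text \<open>The comparable function (1 + |x|)^(2 s) has an elementary antiderivative, which vanishes
  at infinity because 2 s + 1 < 0.\<close>

lemma integrable_bracket_powr:
  assumes s: "s < - 1 / 2"
  shows "integrable lborel (\<lambda>x::real. (1 + x\<^sup>2) powr s)"
proof (rule integrableI_bounded)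
  define p where "p = 2 * s"
  have p: "p < -1" using s by (simp add: p_def)
  let ?f = "\<lambda>x::real. ennreal ((1 + \<bar>x\<bar>) powr p)"
  have F: "((\<lambda>x. (1 + x) powr (p + 1) / (p + 1)) \<longlongrightarrow> 0) at_top"
  proof -
    have "filterlim (\<lambda>x::real. 1 + x) at_top at_top"
      by (rule filterlim_tendsto_add_at_top[OF tendsto_const filterlim_ident])
    then have "((\<lambda>x::real. (1 + x) powr (p + 1)) \<longlongrightarrow> 0) at_top"
      using p by (intro tendsto_neg_powr) auto
    from tendsto_divide[OF this tendsto_const[of "p + 1"]] p show ?thesis by simp
  qed
  have half: "(\<integral>\<^sup>+x. ennreal ((1 + x) powr p) * indicator {0..} x \<partial>lborel) = ennreal (0 - (1 + 0) powr (p + 1) / (p + 1))"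
  proof (rule nn_integral_FTC_atLeast[OF _ _ _ F])
    fix x :: real assume x: "0 \<le> x"
    show "((\<lambda>x. (1 + x) powr (p + 1) / (p + 1)) has_real_derivative (1 + x) powr p) (at x)"
      using x p by (auto intro!: derivative_eq_intros)
  qed auto
  have "(\<integral>\<^sup>+x. ?f x \<partial>lborel) \<le> (\<integral>\<^sup>+x. ?f x * indicator {0..} x + ?f x * indicator {..0} x \<partial>lborel)"
    by (intro nn_integral_mono) (auto simp: indicator_def)
  also have "\<dots> = (\<integral>\<^sup>+x. ?f x * indicator {0..} x \<partial>lborel) + (\<integral>\<^sup>+x. ?f x * indicator {..0} x \<partial>lborel)"
    by (intro nn_integral_add) auto
  also have "(\<integral>\<^sup>+x. ?f x * indicator {..0} x \<partial>lborel) = (\<integral>\<^sup>+x. ?f x * indicator {0..} x \<partial>lborel)"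
    by (subst nn_integral_real_affine[where c = "-1" and t = 0]) (auto intro!: nn_integral_cong simp: indicator_def)
  also have "(\<integral>\<^sup>+x. ?f x * indicator {0..} x \<partial>lborel) = (\<integral>\<^sup>+x. ennreal ((1 + x) powr p) * indicator {0..} x \<partial>lborel)"
    by (intro nn_integral_cong) (auto simp: indicator_def)
  finally have fin: "(\<integral>\<^sup>+x. ?f x \<partial>lborel) < \<infinity>"
    unfolding half by (rule le_less_trans) (simp add: ennreal_plus[symmetric] del: ennreal_plus)
  have le: "(1 + x\<^sup>2) powr s \<le> 2 powr (- s) * (1 + \<bar>x\<bar>) powr p" for x :: real
  proof -
    have "(1 + \<bar>x\<bar>)\<^sup>2 / 2 \<le> 1 + x\<^sup>2"
      using sum_squares_ge_zero[of "1 - \<bar>x\<bar>" 0] by (simp add: power2_eq_square algebra_simps)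
    then have "(1 + x\<^sup>2) powr s \<le> ((1 + \<bar>x\<bar>)\<^sup>2 / 2) powr s"
      using s by (intro powr_mono2') (auto simp: add_pos_nonneg)
    also have "\<dots> = 2 powr (- s) * (1 + \<bar>x\<bar>) powr p"
      by (simp add: powr_divide powr_minus divide_simps p_def powr_powr[symmetric] powr_numeral)
    finally show ?thesis .
  qed
  have "(\<integral>\<^sup>+x. ennreal (norm ((1 + x\<^sup>2) powr s)) \<partial>lborel) \<le> (\<integral>\<^sup>+x. ennreal (2 powr (- s)) * ?f x \<partial>lborel)"
    using le by (intro nn_integral_mono) (auto simp: ennreal_mult[symmetric] intro!: ennreal_leI)
  also have "\<dots> = ennreal (2 powr (- s)) * (\<integral>\<^sup>+x. ?f x \<partial>lborel)"
    by (intro nn_integral_cmult) auto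
  also have "\<dots> < \<infinity>" using fin by (simp add: ennreal_mult_less_top)
  finally show "(\<integral>\<^sup>+x. ennreal (norm ((1 + x\<^sup>2) powr s)) \<partial>lborel) < \<infinity>" .
qed auto

lemma integrable_exp_abs:
  assumes a: "a > 0"
  shows "integrable lborel (\<lambda>x::real. exp (- a * \<bar>x\<bar>))"
proof -
  obtain M where M: "M \<ge> 0" "\<And>x::real. \<bar>x\<bar> ^ 2 * exp (- a * \<bar>x\<bar>) \<le> M"
    using power_exp_bounded[OF a] by blast
  have "integrable lborel (\<lambda>x::real. (1 + M) * (1 + x\<^sup>2) powr (-1))"
    by (intro integrable_mult_right integrable_bracket_powr) simp
  then show ?thesis
  proof (rule Bochner_Integration.integrable_bound)
    show "AE x::real in lborel. norm (exp (- a * \<bar>x\<bar>)) \<le> norm ((1 + M) * (1 + x\<^sup>2) powr (-1))"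
    proof (rule AE_I2)
      fix x :: real
      have "exp (- a * \<bar>x\<bar>) \<le> 1" using a by simp
      moreover have "(1 + x\<^sup>2) * exp (- a * \<bar>x\<bar>) = exp (- a * \<bar>x\<bar>) + \<bar>x\<bar> ^ 2 * exp (- a * \<bar>x\<bar>)"
        by (simp add: distrib_right)
      ultimately have "(1 + x\<^sup>2) * exp (- a * \<bar>x\<bar>) \<le> 1 + M"
        using M(2)[of x] by linarith
      then have "exp (- a * \<bar>x\<bar>) \<le> (1 + M) / (1 + x\<^sup>2)"
        by (simp add: field_simps add_pos_nonneg)
      then show "norm (exp (- a * \<bar>x\<bar>)) \<le> norm ((1 + M) * (1 + x\<^sup>2) powr (-1))"
        using M(1) by (simp add: powr_minus divide_inverse add_pos_nonneg)
    qed
  qed auto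
qed

subsection \<open>Fourier integrals\<close>

definition exp_decay :: "(real \<Rightarrow> real) \<Rightarrow> bool" where
  "exp_decay f \<longleftrightarrow> continuous_on UNIV f \<and> (\<exists>D a. a > 0 \<and> (\<forall>x. \<bar>f x\<bar> \<le> D * exp (- a * \<bar>x\<bar>)))"

text \<open>The Fourier integral without its unitary factor, which reenters as 1 / (2 pi) in
  \<open>cmod_fourier_scaled\<close>.\<close>

definition fourier_int :: "(real \<Rightarrow> real) \<Rightarrow> real \<Rightarrow> complex" where
  "fourier_int f \<xi> = (LINT x|lborel. cis (- (\<xi> * x)) * complex_of_real (f x))"

lemma exp_decay_measurable [measurable_dest]: "exp_decay f \<Longrightarrow> f \<in> borel_measurable borel"
  unfolding exp_decay_def by (auto intro: borel_measurable_continuous_onI)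

lemma exp_decay_integrable:
  assumes "exp_decay f" shows "integrable lborel f"
proof -
  obtain D a where a: "a > 0" and D: "\<And>x. \<bar>f x\<bar> \<le> D * exp (- a * \<bar>x\<bar>)"
    using assms unfolding exp_decay_def by blast
  have "integrable lborel (\<lambda>x. D * exp (- a * \<bar>x\<bar>))"
    using integrable_exp_abs[OF a] by (rule integrable_mult_right)
  then show ?thesis
  proof (rule Bochner_Integration.integrable_bound)
    show "f \<in> borel_measurable lborel" using exp_decay_measurable[OF assms] by simp
    show "AE x in lborel. norm (f x) \<le> norm (D * exp (- a * \<bar>x\<bar>))"
      unfolding real_norm_def by (rule AE_I2) (rule order_trans[OF D abs_ge_self])
  qed
qed

lemma cis_measurable [measurable]: "(\<lambda>x. cis (- (\<xi> * x))) \<in> borel_measurable borel"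
  by (intro borel_measurable_continuous_onI continuous_intros)

lemma fourier_integrable:
  assumes "integrable lborel f"
  shows "integrable lborel (\<lambda>x. cis (- (\<xi> * x)) * complex_of_real (f x))"
  by (rule Bochner_Integration.integrable_bound[OF assms])
    (use assms in \<open>auto simp: norm_mult\<close>)

lemma fourier_int_bound:
  assumes "integrable lborel f"
  shows "cmod (fourier_int f \<xi>) \<le> (LINT x|lborel. \<bar>f x\<bar>)"
proof -
  have "cmod (fourier_int f \<xi>) \<le> (LINT x|lborel. cmod (cis (- (\<xi> * x)) * complex_of_real (f x)))"
    unfolding fourier_int_def by (rule integral_norm_bound)
  then show ?thesis by (simp add: norm_mult)
qed

lemma fourier_int_0: "fourier_int f 0 = complex_of_real (LINT x|lborel. f x)"
  unfolding fourier_int_def by simp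

text \<open>\<open>f\<close> is real-valued. The symmetry lets a negative scale l be replaced by |l|
  in moduli.\<close>

lemma fourier_int_minus: "fourier_int f (- \<xi>) = cnj (fourier_int f \<xi>)"
  unfolding fourier_int_def
  by (subst Bochner_Integration.integral_cnj[symmetric]) (simp add: cis_cnj)

lemma fourier_int_affine:
  assumes c: "c \<noteq> 0"
  shows "fourier_int (\<lambda>x. f (c * (x - d))) \<xi> = cis (- (\<xi> * d)) * fourier_int f (\<xi> / c) / \<bar>c\<bar>"
proof -
  have "fourier_int (\<lambda>x. f (c * (x - d))) \<xi>
      = \<bar>1 / c\<bar> *\<^sub>R (LINT y|lborel. cis (- (\<xi> * (d + 1 / c * y))) * complex_of_real (f (c * (d + 1 / c * y - d))))"
    unfolding fourier_int_def using c by (intro lborel_integral_real_affine) simp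
  also have "(\<lambda>y. cis (- (\<xi> * (d + 1 / c * y))) * complex_of_real (f (c * (d + 1 / c * y - d))))
      = (\<lambda>y. cis (- (\<xi> * d)) * (cis (- (\<xi> / c * y)) * complex_of_real (f y)))"
  proof
    fix y
    have "cis (- (\<xi> * (d + 1 / c * y))) = cis (- (\<xi> * d)) * cis (- (\<xi> / c * y))"
      unfolding cis_mult by (simp add: algebra_simps)
    moreover have "c * (d + 1 / c * y - d) = y" using c by simp
    ultimately show "cis (- (\<xi> * (d + 1 / c * y))) * complex_of_real (f (c * (d + 1 / c * y - d)))
        = cis (- (\<xi> * d)) * (cis (- (\<xi> / c * y)) * complex_of_real (f y))"
      by (simp only: mult.assoc)
  qed
  finally show ?thesis unfolding fourier_int_def integral_mult_right_zero
    by (simp add: scaleR_conv_of_real)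
qed

lemma cis_minus_1_le: "cmod (cis y - 1) \<le> \<bar>y\<bar>"
proof -
  have "(cmod (cis y - 1))\<^sup>2 = (cos y - 1)\<^sup>2 + (sin y)\<^sup>2"
    by (simp add: cmod_power2)
  also have "\<dots> = 2 - 2 * cos (2 * (y / 2))"
    using sin_cos_squared_add[of y] by (simp add: power2_eq_square algebra_simps)
  also have "\<dots> = (2 * sin (y / 2))\<^sup>2"
    unfolding cos_double_sin by (simp add: power2_eq_square)
  also have "\<dots> = (2 * \<bar>sin (y / 2)\<bar>)\<^sup>2"
    by (simp add: power_mult_distrib)
  also have "\<dots> \<le> \<bar>y\<bar>\<^sup>2"
    using abs_sin_x_le_abs_x[of "y / 2"] by (intro power_mono) auto
  finally show ?thesis by (rule power2_le_imp_le) simp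
qed

text \<open>The constant is the first absolute moment of \<open>f\<close>. For mass zero this is
  linear vanishing at frequency 0, enough to beat the weight 1 / |\<xi>| of the homogeneous
  norm.\<close>

lemma fourier_int_lipschitz:
  assumes f: "exp_decay f"
  shows "\<exists>L\<ge>0. \<forall>\<xi>. cmod (fourier_int f \<xi> - fourier_int f 0) \<le> L * \<bar>\<xi>\<bar>"
proof -
  obtain D a where a: "a > 0" and D: "\<And>x. \<bar>f x\<bar> \<le> D * exp (- a * \<bar>x\<bar>)"
    using f unfolding exp_decay_def by blast
  have D0: "D \<ge> 0" using D[of 0] by simp
  obtain M where M: "M \<ge> 0" "\<And>x::real. \<bar>x\<bar> ^ 1 * exp (- (a/2) * \<bar>x\<bar>) \<le> M"
    using power_exp_bounded[of "a/2" 1] a by auto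
  have meas: "f \<in> borel_measurable borel" using f by (rule exp_decay_measurable)
  have "\<bar>x * f x\<bar> \<le> D * M * exp (- (a/2) * \<bar>x\<bar>)" for x
  proof -
    have "\<bar>x * f x\<bar> \<le> \<bar>x\<bar> * (D * (exp (- (a/2) * \<bar>x\<bar>) * exp (- (a/2) * \<bar>x\<bar>)))"
      using D[of x] unfolding abs_mult by (intro mult_left_mono) (auto simp: exp_add[symmetric])
    also have "\<dots> = D * (\<bar>x\<bar> ^ 1 * exp (- (a/2) * \<bar>x\<bar>)) * exp (- (a/2) * \<bar>x\<bar>)" by simp
    also have "\<dots> \<le> D * M * exp (- (a/2) * \<bar>x\<bar>)"
      using D0 by (intro mult_right_mono mult_left_mono M(2)) auto
    finally show ?thesis .
  qed
  note xf = this
  have int: "integrable lborel (\<lambda>x. x * f x)"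
    by (rule Bochner_Integration.integrable_bound[OF integrable_mult_right[OF integrable_exp_abs[of "a/2"], of "D * M"]])
      (use a meas xf in \<open>auto intro!: AE_I2 order_trans[OF xf]\<close>)
  have "cmod (fourier_int f \<xi> - fourier_int f 0) \<le> (LINT x|lborel. \<bar>x * f x\<bar>) * \<bar>\<xi>\<bar>" for \<xi>
  proof -
    have i: "integrable lborel f" using f by (rule exp_decay_integrable)
    have "fourier_int f \<xi> - fourier_int f 0
        = (LINT x|lborel. cis (- (\<xi> * x)) * complex_of_real (f x) - cis (- (0 * x)) * complex_of_real (f x))"
      unfolding fourier_int_def using fourier_integrable[OF i] by (intro Bochner_Integration.integral_diff[symmetric])
    then have "cmod (fourier_int f \<xi> - fourier_int f 0)
        \<le> (LINT x|lborel. cmod (cis (- (\<xi> * x)) * complex_of_real (f x) - cis (- (0 * x)) * complex_of_real (f x)))"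
      by (simp only: integral_norm_bound)
    also have "\<dots> \<le> (LINT x|lborel. \<bar>x * f x\<bar> * \<bar>\<xi>\<bar>)"
    proof (rule integral_mono)
      show "integrable lborel (\<lambda>x. cmod (cis (- (\<xi> * x)) * complex_of_real (f x) - cis (- (0 * x)) * complex_of_real (f x)))"
        by (intro integrable_norm Bochner_Integration.integrable_diff fourier_integrable i)
      show "integrable lborel (\<lambda>x. \<bar>x * f x\<bar> * \<bar>\<xi>\<bar>)"
        by (intro integrable_mult_left integrable_abs int)
      fix x
      have "cmod (cis (- (\<xi> * x)) * complex_of_real (f x) - cis (- (0 * x)) * complex_of_real (f x))
          = cmod (cis (- (\<xi> * x)) - 1) * \<bar>f x\<bar>"
        by (simp add: norm_mult[symmetric] left_diff_distrib)
           (metis left_diff_distrib mult_1 norm_mult norm_of_real)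
      also have "\<dots> \<le> \<bar>\<xi> * x\<bar> * \<bar>f x\<bar>"
        using cis_minus_1_le[of "- (\<xi> * x)"] by (intro mult_right_mono) auto
      finally show "cmod (cis (- (\<xi> * x)) * complex_of_real (f x) - cis (- (0 * x)) * complex_of_real (f x)) \<le> \<bar>x * f x\<bar> * \<bar>\<xi>\<bar>"
        by (simp add: abs_mult mult_ac)
    qed
    finally show ?thesis by simp
  qed
  moreover have "(LINT x|lborel. \<bar>x * f x\<bar>) \<ge> 0" by simp
  ultimately show ?thesis by blast
qed

lemma exp_abs_tendsto_0:
  assumes a: "a > 0"
  shows "((\<lambda>x::real. exp (- a * \<bar>x\<bar>)) \<longlongrightarrow> 0) at_infinity"
proof -
  have "filterlim (\<lambda>x::real. a * \<bar>x\<bar>) at_top at_infinity"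
    using filterlim_tendsto_pos_mult_at_top[OF tendsto_const a filterlim_norm_at_top[where 'a = real]] by simp
  then have "filterlim (\<lambda>x::real. - a * \<bar>x\<bar>) at_bot at_infinity"
    by (simp add: filterlim_uminus_at_top)
  from filterlim_compose[OF exp_at_bot this] show ?thesis .
qed

text \<open>The derivative of exp(-i \<xi> x) u(x) integrates to zero over the line, because the
  product vanishes at both ends.\<close>

lemma fourier_int_deriv:
  assumes u: "exp_decay u" and u': "exp_decay u'" and d: "\<And>x. (u has_real_derivative u' x) (at x)"
  shows "fourier_int u' \<xi> = \<i> * complex_of_real \<xi> * fourier_int u \<xi>"
proof -
  let ?W = "\<lambda>x. cis (- (\<xi> * x)) * complex_of_real (u x)"
  let ?f = "\<lambda>x. cis (- (\<xi> * x)) * complex_of_real (u' x) - \<i> * complex_of_real \<xi> * (cis (- (\<xi> * x)) * complex_of_real (u x))"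
  have int: "integrable lborel ?f"
    using u u' by (intro Bochner_Integration.integrable_diff integrable_mult_right fourier_integrable exp_decay_integrable)
  obtain D a where a: "a > 0" and D: "\<And>x. \<bar>u x\<bar> \<le> D * exp (- a * \<bar>x\<bar>)"
    using u unfolding exp_decay_def by blast
  have lim: "(?W \<longlongrightarrow> 0) at_infinity"
  proof (rule Lim_null_comparison)
    show "\<forall>\<^sub>F x in at_infinity. norm (?W x) \<le> D * exp (- a * \<bar>x\<bar>)"
      using D by (simp add: norm_mult)
    show "((\<lambda>x. D * exp (- a * \<bar>x\<bar>)) \<longlongrightarrow> 0) at_infinity"
      using tendsto_mult_left[OF exp_abs_tendsto_0[OF a], of D] by simp
  qed
  have deriv: "(?W has_vector_derivative ?f x) (at x)" for x
  proof -
    have "((\<lambda>x. cis (- (\<xi> * x))) has_vector_derivative (- \<xi>) *\<^sub>R (\<i> * cis (- (\<xi> * x)))) (at x)"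
      unfolding has_vector_derivative_def
      by (auto intro!: derivative_eq_intros simp: scaleR_conv_of_real algebra_simps)
    moreover have "((\<lambda>x. complex_of_real (u x)) has_vector_derivative complex_of_real (u' x)) (at x)"
      using d[of x] by (rule has_vector_derivative_of_real)
    ultimately show ?thesis
      by (rule has_vector_derivative_eq_rhs[OF has_vector_derivative_mult])
         (simp add: scaleR_conv_of_real algebra_simps)
  qed
  have cont: "isCont ?f x" for x
  proof -
    have "continuous_on UNIV ?f"
      using u u' unfolding exp_decay_def by (intro continuous_intros) auto
    then show ?thesis by (simp add: continuous_on_eq_continuous_at)
  qed
  have "(LBINT x=-\<infinity>..\<infinity>. ?f x) = 0 - 0"
  proof (rule interval_integral_FTC_integrable[where F = ?W])
    show "set_integrable lborel (einterval (-\<infinity>) \<infinity>) ?f"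
      using int by (simp add: set_integrable_def)
    show "((?W \<circ> real_of_ereal) \<longlongrightarrow> 0) (at_right (-\<infinity>))" "((?W \<circ> real_of_ereal) \<longlongrightarrow> 0) (at_left \<infinity>)"
      unfolding ereal_tendsto_simps
      by (rule tendsto_mono[OF _ lim], simp add: at_bot_le_at_infinity at_top_le_at_infinity)+
  qed (auto intro: deriv cont)
  then have "(LINT x|lborel. ?f x) = 0"
    by (simp add: interval_lebesgue_integral_def set_lebesgue_integral_def)
  also have "(LINT x|lborel. ?f x) = fourier_int u' \<xi> - \<i> * complex_of_real \<xi> * fourier_int u \<xi>"
    unfolding fourier_int_def using u u'
    by (subst Bochner_Integration.integral_diff)
       (auto intro!: integrable_mult_right fourier_integrable exp_decay_integrable)
  finally show ?thesis by simp
qed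

lemma exp_decay_sech: "exp_decay sech"
  unfolding exp_decay_def
proof (intro conjI exI allI)
  show "continuous_on UNIV sech"
    by (intro continuous_intros) auto
  show "\<bar>sech x\<bar> \<le> 2 * exp (- 1 * \<bar>x\<bar>)" for x using sech_le_exp[of x] by simp
qed simp

text \<open>Every soliton 2 k / cosh (2 k x) with k > 0 has this mass, whatever its k, so
  alternating signs cancel exactly in pairs.\<close>

definition sech_mass :: real where "sech_mass = (LINT y|lborel. sech y)"

lemma sech_mass_pos: "sech_mass > 0"
proof -
  have "AE y in lborel. 0 \<le> sech y" by simp
  moreover have "\<not> (AE y in (lborel :: real measure). False)"
    using ae_filter_eq_bot_iff[of "lborel :: real measure"] by (simp add: trivial_limit_def)
  then have "\<not> (AE y in lborel. sech y = 0)" by simp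
  ultimately have "sech_mass \<noteq> 0" unfolding sech_mass_def
    using integral_nonneg_eq_0_iff_AE[OF exp_decay_integrable[OF exp_decay_sech]] by blast
  moreover have "sech_mass \<ge> 0" unfolding sech_mass_def by (intro integral_nonneg_AE) simp
  ultimately show ?thesis by simp
qed

section \<open>Fourier transform of the multisoliton, at large times and at time zero\<close>

context soliton_train
begin

lemma exp_decay_sech_sum:
  assumes "continuous_on UNIV f" "\<And>x. \<bar>f x\<bar> \<le> D * sech_sum n t x" "D \<ge> 0"
  shows "exp_decay f"
  unfolding exp_decay_def
proof (intro conjI exI allI)
  show "2 * k 0 > 0" using k0_pos by simp
  fix x
  have "\<bar>f x\<bar> \<le> D * (2 * real n * exp (8 * k n ^ 3 * \<bar>t\<bar>) * exp (- 2 * k 0 * \<bar>x\<bar>))"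
    using assms(2)[of x] by (rule order_trans) (intro mult_left_mono sech_sum_exp assms)
  then show "\<bar>f x\<bar> \<le> D * (2 * real n * exp (8 * k n ^ 3 * \<bar>t\<bar>)) * exp (- (2 * k 0) * \<bar>x\<bar>)"
    by (simp add: mult.assoc)
qed (rule assms)

lemma x_deriv_continuous: "x_deriv f g \<Longrightarrow> continuous_on UNIV (f t)"
  unfolding x_deriv_def by (meson DERIV_isCont continuous_at_imp_continuous_on)

lemma exp_decay_G:
  assumes "f \<in> G n"
  shows "exp_decay (f t)"
proof -
  obtain g where "x_deriv f g" using G_derivs[OF assms] unfolding has_derivs_in_def by blast
  then have c: "continuous_on UNIV (f t)" by (rule x_deriv_continuous)
  obtain D where D: "D \<ge> 0" "\<And>t x. \<bar>f t x\<bar> \<le> D * sech_sum n t x"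
    using G_decay[OF assms] by blast
  show ?thesis by (rule exp_decay_sech_sum[OF c D(2) D(1)])
qed

lemma q_G: "q n \<in> G n"
  using lax_hierarchy[of n] by blast

lemma theta_affine: "theta i t x = 2 * k i * (x - 4 * (k i)\<^sup>2 * t)"
  by (simp add: theta_def algebra_simps power2_eq_square power3_eq_cube)

lemma exp_decay_soliton: "exp_decay (\<lambda>x. 2 * k i / cosh (theta i t x))"
proof (rule exp_decay_sech_sum)
  show "continuous_on UNIV (\<lambda>x. 2 * k i / cosh (theta i t x))"
    unfolding theta_def by (intro continuous_intros) auto
  show "\<bar>2 * k i / cosh (theta i t x)\<bar> \<le> (2 * k i) * sech_sum (Suc i) t x" for x
  proof -
    have "sech (theta i t x) \<le> sech_sum (Suc i) t x"
      using sech_sum_nonneg[of i t x] by (simp add: sech_sum_def)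
    then have "(2 * k i) * sech (theta i t x) \<le> (2 * k i) * sech_sum (Suc i) t x"
      using k_pos[of i] by (intro mult_left_mono) auto
    then show ?thesis using k_pos[of i] by simp
  qed
  show "0 \<le> 2 * k i" using k_pos[of i] by simp
qed

lemma fourier_int_soliton:
  "fourier_int (\<lambda>x. 2 * k i / cosh (theta i t x)) \<xi>
     = cis (- (\<xi> * (4 * (k i)\<^sup>2 * t))) * fourier_int sech (\<xi> / (2 * k i))"
proof -
  have "fourier_int (\<lambda>x. 2 * k i / cosh (theta i t x)) \<xi>
      = complex_of_real (2 * k i) * fourier_int (\<lambda>x. sech (2 * k i * (x - 4 * (k i)\<^sup>2 * t))) \<xi>"
    unfolding fourier_int_def theta_affine integral_mult_right_zero[symmetric]
    by (intro Bochner_Integration.integral_cong) (auto simp: field_simps)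
  also have "\<dots> = complex_of_real (2 * k i) * (cis (- (\<xi> * (4 * (k i)\<^sup>2 * t))) * fourier_int sech (\<xi> / (2 * k i)) / \<bar>2 * k i\<bar>)"
    using k_pos[of i] by (subst fourier_int_affine) auto
  finally show ?thesis using k_pos[of i] by simp
qed

text \<open>Translating each bump to the origin removes t from the integral.\<close>

lemma integral_sech_sum: "(LINT x|lborel. sech_sum n t x) = (\<Sum>i<n. sech_mass / (2 * k i))"
  and integrable_sech_sum: "integrable lborel (sech_sum n t)"
proof -
  have int: "integrable lborel (\<lambda>x. sech (theta i t x))" for i
    using integrable_mult_right[OF exp_decay_integrable[OF exp_decay_soliton[of i t]], of "1 / (2 * k i)"] k_pos[of i]
    by simp
  have val: "(LINT x|lborel. sech (theta i t x)) = sech_mass / (2 * k i)" for i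
  proof -
    have "(LINT x|lborel. sech (theta i t x))
        = \<bar>1 / (2 * k i)\<bar> *\<^sub>R (LINT y|lborel. sech (theta i t (4 * (k i)\<^sup>2 * t + 1 / (2 * k i) * y)))"
      using k_pos[of i] by (intro lborel_integral_real_affine) simp
    then show ?thesis using k_pos[of i] unfolding theta_affine sech_mass_def by simp
  qed
  show "integrable lborel (sech_sum n t)"
    unfolding sech_sum_def[abs_def] using int by (intro Bochner_Integration.integrable_sum)
  show "(LINT x|lborel. sech_sum n t x) = (\<Sum>i<n. sech_mass / (2 * k i))"
    unfolding sech_sum_def using int by (subst Bochner_Integration.integral_sum) (auto simp: val)
qed

text \<open>The difference between \<open>q n\<close> and the alternating sum of free solitons is
  the x-derivative of the function R of \<open>potential_remainder\<close>. Integration by parts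
  turns it into i \<xi> times the transform of R, which is bounded by an L^1 norm uniformly in t.
  This uniformity allows t to grow while \<xi> shrinks like 1 / t.\<close>

lemma fourier_int_q:
  "\<exists>L\<ge>0. \<exists>\<rho>. (\<forall>t \<xi>. cmod (\<rho> t \<xi>) \<le> L) \<and> (\<forall>t \<xi>. fourier_int (q n t) \<xi> =
     (\<Sum>i<n. (-1) ^ (n - 1 - i) * (cis (- (\<xi> * (4 * (k i)\<^sup>2 * t))) * fourier_int sech (\<xi> / (2 * k i))))
     + \<i> * complex_of_real \<xi> * \<rho> t \<xi>)"
proof -
  obtain R D where D: "D \<ge> 0" and R: "\<And>t x. \<bar>R t x\<bar> \<le> D * sech_sum n t x"
    and Rx: "x_deriv R (\<lambda>t x. q n t x - (\<Sum>i<n. (-1) ^ (n - 1 - i) * (2 * k i / cosh (theta i t x))))"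
    using potential_remainder by blast
  define R' where "R' t x = q n t x - (\<Sum>i<n. (-1) ^ (n - 1 - i) * (2 * k i / cosh (theta i t x)))" for t x
  have dR: "exp_decay (R t)" for t by (rule exp_decay_sech_sum[OF x_deriv_continuous[OF Rx] R D])
  obtain D1 where D1: "D1 \<ge> 0" "\<And>t x. \<bar>q n t x\<bar> \<le> D1 * sech_sum n t x" using G_decay[OF q_G] by blast
  have dR': "exp_decay (R' t)" for t
  proof (rule exp_decay_sech_sum)
    have "continuous_on UNIV (q n t)" "continuous_on UNIV (\<lambda>x. 2 * k i / cosh (theta i t x))" for i
      using exp_decay_G[OF q_G] exp_decay_soliton unfolding exp_decay_def by auto
    then show "continuous_on UNIV (R' t)"
      unfolding R'_def[abs_def]
      by (intro continuous_on_diff continuous_on_sum continuous_on_mult continuous_on_const)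
    show "\<bar>R' t x\<bar> \<le> (D1 + 2 * k n) * sech_sum n t x" for x
    proof -
      have "\<bar>\<Sum>i<n. (-1) ^ (n - 1 - i) * (2 * k i / cosh (theta i t x))\<bar> \<le> (\<Sum>i<n. 2 * k n * sech (theta i t x))"
      proof -
        have "\<bar>\<Sum>i<n. (-1) ^ (n - 1 - i) * (2 * k i / cosh (theta i t x))\<bar>
            \<le> (\<Sum>i<n. \<bar>(-1) ^ (n - 1 - i) * (2 * k i / cosh (theta i t x))\<bar>)" by (rule sum_abs)
        also have "\<dots> \<le> (\<Sum>i<n. 2 * k n * sech (theta i t x))"
        proof (rule sum_mono)
          fix i assume "i \<in> {..<n}"
          then have "2 * k i * sech (theta i t x) \<le> 2 * k n * sech (theta i t x)"
            using k_less[of i n] by (intro mult_right_mono) auto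
          then show "\<bar>(-1) ^ (n - 1 - i) * (2 * k i / cosh (theta i t x))\<bar> \<le> 2 * k n * sech (theta i t x)"
            using k_pos[of i] by (simp add: abs_mult power_abs)
        qed
        finally show ?thesis .
      qed
      also have "\<dots> = 2 * k n * sech_sum n t x" unfolding sech_sum_def by (simp add: sum_distrib_left)
      finally show ?thesis
        unfolding R'_def distrib_right using D1(2)[of t x]
          abs_triangle_ineq4[of "q n t x" "\<Sum>i<n. (-1) ^ (n - 1 - i) * (2 * k i / cosh (theta i t x))"] by linarith
    qed
    show "D1 + 2 * k n \<ge> 0" using D1 k_pos[of n] by simp
  qed
  have ibp: "fourier_int (R' t) \<xi> = \<i> * complex_of_real \<xi> * fourier_int (R t) \<xi>" for t \<xi>
    using Rx unfolding x_deriv_def R'_def[symmetric] by (intro fourier_int_deriv dR dR') auto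
  have bound: "cmod (fourier_int (R t) \<xi>) \<le> D * (\<Sum>i<n. sech_mass / (2 * k i))" for t \<xi>
  proof -
    have "cmod (fourier_int (R t) \<xi>) \<le> (LINT x|lborel. \<bar>R t x\<bar>)"
      by (intro fourier_int_bound exp_decay_integrable dR)
    also have "\<dots> \<le> (LINT x|lborel. D * sech_sum n t x)"
      by (intro integral_mono R integrable_abs exp_decay_integrable dR integrable_mult_right integrable_sech_sum)
    also have "\<dots> = D * (\<Sum>i<n. sech_mass / (2 * k i))" by (simp add: integral_sech_sum)
    finally show ?thesis .
  qed
  have "fourier_int (q n t) \<xi> =
     (\<Sum>i<n. (-1) ^ (n - 1 - i) * (cis (- (\<xi> * (4 * (k i)\<^sup>2 * t))) * fourier_int sech (\<xi> / (2 * k i))))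
     + \<i> * complex_of_real \<xi> * fourier_int (R t) \<xi>" for t \<xi>
  proof -
    let ?e = "\<lambda>f x. cis (- (\<xi> * x)) * complex_of_real (f x)"
    have eq: "?e (q n t) = (\<lambda>x. ?e (R' t) x + (\<Sum>i<n. (-1) ^ (n - 1 - i) * ?e (\<lambda>x. 2 * k i / cosh (theta i t x)) x))"
    proof
      fix x
      have "complex_of_real (q n t x)
          = complex_of_real (R' t x) + (\<Sum>i<n. (-1) ^ (n - 1 - i) * complex_of_real (2 * k i / cosh (theta i t x)))"
        by (simp add: R'_def)
      then show "?e (q n t) x = ?e (R' t) x + (\<Sum>i<n. (-1) ^ (n - 1 - i) * ?e (\<lambda>x. 2 * k i / cosh (theta i t x)) x)"
        by (simp only: distrib_left sum_distrib_left mult.left_commute)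
    qed
    have i: "integrable lborel (?e (R' t))" "\<And>i. integrable lborel (\<lambda>x. (-1) ^ (n - 1 - i) * ?e (\<lambda>x. 2 * k i / cosh (theta i t x)) x)"
      by (intro integrable_mult_right fourier_integrable exp_decay_integrable dR' exp_decay_soliton)+
    have "fourier_int (q n t) \<xi> = fourier_int (R' t) \<xi>
        + (\<Sum>i<n. (LINT x|lborel. (-1) ^ (n - 1 - i) * ?e (\<lambda>x. 2 * k i / cosh (theta i t x)) x))"
      unfolding fourier_int_def eq
      by (simp only: Bochner_Integration.integral_add Bochner_Integration.integral_sum
          Bochner_Integration.integrable_sum i)
    also have "\<dots> = fourier_int (R' t) \<xi>
        + (\<Sum>i<n. (-1) ^ (n - 1 - i) * fourier_int (\<lambda>x. 2 * k i / cosh (theta i t x)) \<xi>)"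
      unfolding fourier_int_def integral_mult_right_zero ..
    finally have "fourier_int (q n t) \<xi> = fourier_int (R' t) \<xi>
        + (\<Sum>i<n. (-1) ^ (n - 1 - i) * fourier_int (\<lambda>x. 2 * k i / cosh (theta i t x)) \<xi>)" .
    then show ?thesis unfolding ibp fourier_int_soliton by (simp add: add.commute)
  qed
  moreover have "D * (\<Sum>i<n. sech_mass / (2 * k i)) \<ge> 0"
    using D sech_mass_pos k_pos by (intro mult_nonneg_nonneg sum_nonneg) (auto intro: less_imp_le)
  ultimately show ?thesis
    using bound by (intro exI[of _ "D * (\<Sum>i<n. sech_mass / (2 * k i))"] exI[of _ "\<lambda>t. fourier_int (R t)"] conjI allI)
qed

text \<open>The Fourier transform of unit point masses with alternating signs at the points 4 (k
  i)^2.\<close>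

definition profile :: "nat \<Rightarrow> real \<Rightarrow> complex" where
  "profile n \<eta> = (\<Sum>i<n. (-1) ^ (n - 1 - i) * cis (- (4 * (k i)\<^sup>2 * \<eta>)))"

text \<open>At time T and frequency \<eta> / T the phase of soliton i is 4 (k i)^2 \<eta>, free of
  T. Its shape factor tends to the value at frequency 0, the mass, and the remainder is
  O(1/T).\<close>

lemma fourier_int_q_limit:
  assumes T: "filterlim T at_top F"
  shows "((\<lambda>j. fourier_int (q n (T j)) (\<eta> / T j)) \<longlongrightarrow> complex_of_real sech_mass * profile n \<eta>) F"
proof -
  obtain L \<rho> where L: "L \<ge> 0" "\<And>t \<xi>. cmod (\<rho> t \<xi>) \<le> L" and eq: "\<And>t \<xi>. fourier_int (q n t) \<xi> =
     (\<Sum>i<n. (-1) ^ (n - 1 - i) * (cis (- (\<xi> * (4 * (k i)\<^sup>2 * t))) * fourier_int sech (\<xi> / (2 * k i))))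
     + \<i> * complex_of_real \<xi> * \<rho> t \<xi>" using fourier_int_q by blast
  obtain M where M: "M \<ge> 0" "\<And>\<xi>. cmod (fourier_int sech \<xi> - fourier_int sech 0) \<le> M * \<bar>\<xi>\<bar>"
    using fourier_int_lipschitz[OF exp_decay_sech] by blast
  have inv: "((\<lambda>j. \<eta> / T j) \<longlongrightarrow> 0) F"
    by (rule tendsto_divide_0[OF tendsto_const]) (rule filterlim_mono[OF T at_top_le_at_infinity order.refl])
  have sech_lim: "((\<lambda>j. fourier_int sech (\<eta> / T j / (2 * k i))) \<longlongrightarrow> fourier_int sech 0) F" for i
  proof (rule LIM_zero_cancel, rule Lim_null_comparison)
    show "\<forall>\<^sub>F j in F. norm (fourier_int sech (\<eta> / T j / (2 * k i)) - fourier_int sech 0) \<le> M * \<bar>\<eta> / T j / (2 * k i)\<bar>"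
      by (intro always_eventually allI M(2))
    have "((\<lambda>j. M * \<bar>\<eta> / T j / (2 * k i)\<bar>) \<longlongrightarrow> M * \<bar>0 / (2 * k i)\<bar>) F"
      using k_pos[of i] by (intro tendsto_intros inv) simp
    then show "((\<lambda>j. M * \<bar>\<eta> / T j / (2 * k i)\<bar>) \<longlongrightarrow> 0) F" by simp
  qed
  have rem: "((\<lambda>j. \<i> * complex_of_real (\<eta> / T j) * \<rho> (T j) (\<eta> / T j)) \<longlongrightarrow> 0) F"
  proof (rule Lim_null_comparison)
    show "\<forall>\<^sub>F j in F. norm (\<i> * complex_of_real (\<eta> / T j) * \<rho> (T j) (\<eta> / T j)) \<le> \<bar>\<eta> / T j\<bar> * L"
      unfolding norm_mult norm_ii norm_of_real by (intro always_eventually allI) (simp add: mult_left_mono L del: abs_divide)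
    show "((\<lambda>j. \<bar>\<eta> / T j\<bar> * L) \<longlongrightarrow> 0) F"
      using tendsto_mult_right[OF tendsto_rabs_zero[OF inv], of L] by simp
  qed
  have "((\<lambda>j. (\<Sum>i<n. (-1) ^ (n - 1 - i) * (cis (- (4 * (k i)\<^sup>2 * \<eta>)) * fourier_int sech (\<eta> / T j / (2 * k i))))
     + \<i> * complex_of_real (\<eta> / T j) * \<rho> (T j) (\<eta> / T j))
     \<longlongrightarrow> (\<Sum>i<n. (-1) ^ (n - 1 - i) * (cis (- (4 * (k i)\<^sup>2 * \<eta>)) * fourier_int sech 0)) + 0) F"
    by (intro tendsto_intros sech_lim rem)
  moreover have "(\<Sum>i<n. (-1) ^ (n - 1 - i) * (cis (- (4 * (k i)\<^sup>2 * \<eta>)) * fourier_int sech 0)) + 0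
     = complex_of_real sech_mass * profile n \<eta>"
    unfolding profile_def fourier_int_0 sech_mass_def by (simp add: sum_distrib_left mult_ac)
  moreover have "\<forall>\<^sub>F j in F. fourier_int (q n (T j)) (\<eta> / T j) =
     (\<Sum>i<n. (-1) ^ (n - 1 - i) * (cis (- (4 * (k i)\<^sup>2 * \<eta>)) * fourier_int sech (\<eta> / T j / (2 * k i))))
     + \<i> * complex_of_real (\<eta> / T j) * \<rho> (T j) (\<eta> / T j)"
    using eventually_compose_filterlim[OF eventually_gt_at_top[of 0] T]
  proof eventually_elim
    case (elim j)
    then have "\<eta> / T j * (4 * (k i)\<^sup>2 * T j) = 4 * (k i)\<^sup>2 * \<eta>" for i by simp
    then show ?case unfolding eq by simp
  qed
  ultimately show ?thesis by (simp add: tendsto_cong)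
qed

text \<open>An even number of solitons has mass zero, whence the bound linear in \<xi>; the other
  two come from the L^1 norms of \<open>q n 0\<close> and of its derivative. Together they control
  the homogeneous norm at both low and high frequencies.\<close>

lemma fourier_int_q_initial:
  assumes n: "even n"
  shows "\<exists>L\<ge>0. \<forall>\<xi>. cmod (fourier_int (q n 0) \<xi>) \<le> L * \<bar>\<xi>\<bar> \<and> cmod (fourier_int (q n 0) \<xi>) \<le> L \<and>
    \<bar>\<xi>\<bar> * cmod (fourier_int (q n 0) \<xi>) \<le> L"
proof -
  have alt: "(\<Sum>i<n. (-1) ^ (n - 1 - i)) = (0::complex)"
  proof -
    have "(\<Sum>i<n. (-1) ^ (n - Suc i)) = (\<Sum>i<n. (-1::complex) ^ i)" by (rule sum.nat_diff_reindex)
    moreover have "(\<Sum>i<2 * m. (-1::complex) ^ i) = 0" for m by (induction m) auto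
    moreover obtain m where "n = 2 * m" using n by blast
    ultimately show ?thesis by simp
  qed
  have zero: "fourier_int (q n 0) 0 = 0"
  proof -
    obtain \<rho> where "\<And>t \<xi>. fourier_int (q n t) \<xi> =
     (\<Sum>i<n. (-1) ^ (n - 1 - i) * (cis (- (\<xi> * (4 * (k i)\<^sup>2 * t))) * fourier_int sech (\<xi> / (2 * k i))))
     + \<i> * complex_of_real \<xi> * \<rho> t \<xi>" using fourier_int_q[of n] by blast
    then have "fourier_int (q n 0) 0 = (\<Sum>i<n. (-1) ^ (n - 1 - i)) * fourier_int sech 0"
      by (simp add: sum_distrib_right)
    then show ?thesis by (simp only: alt mult_zero_left)
  qed
  obtain L1 where L1: "L1 \<ge> 0" "\<And>\<xi>. cmod (fourier_int (q n 0) \<xi> - fourier_int (q n 0) 0) \<le> L1 * \<bar>\<xi>\<bar>"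
    using fourier_int_lipschitz[OF exp_decay_G[OF q_G]] by blast
  define L2 where "L2 = (LINT x|lborel. \<bar>q n 0 x\<bar>)"
  have L2: "cmod (fourier_int (q n 0) \<xi>) \<le> L2" "L2 \<ge> 0" for \<xi>
    unfolding L2_def by (auto intro!: fourier_int_bound exp_decay_integrable exp_decay_G[OF q_G])
  obtain q1 where q1: "q1 \<in> G n" "x_deriv (q n) q1" using G_derivs[OF q_G] unfolding has_derivs_in_def by blast
  define L3 where "L3 = (LINT x|lborel. \<bar>q1 0 x\<bar>)"
  have L3: "L3 \<ge> 0" unfolding L3_def by simp
  have L3': "\<bar>\<xi>\<bar> * cmod (fourier_int (q n 0) \<xi>) \<le> L3" for \<xi>
  proof -
    have "fourier_int (q1 0) \<xi> = \<i> * complex_of_real \<xi> * fourier_int (q n 0) \<xi>"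
      using q1(2) unfolding x_deriv_def by (intro fourier_int_deriv exp_decay_G[OF q_G] exp_decay_G[OF q1(1)]) auto
    then have "\<bar>\<xi>\<bar> * cmod (fourier_int (q n 0) \<xi>) = cmod (fourier_int (q1 0) \<xi>)" by (simp add: norm_mult)
    also have "\<dots> \<le> L3" unfolding L3_def by (intro fourier_int_bound exp_decay_integrable exp_decay_G[OF q1(1)])
    finally show ?thesis .
  qed
  define L where "L = L1 + L2 + L3"
  have "L1 \<le> L" "L2 \<le> L" "L3 \<le> L" "L \<ge> 0" using L1 L2 L3 by (auto simp: L_def)
  moreover from this have "cmod (fourier_int (q n 0) \<xi>) \<le> L * \<bar>\<xi>\<bar>" for \<xi>
    using L1(2)[of \<xi>] mult_right_mono[of L1 L "\<bar>\<xi>\<bar>"] unfolding zero by simp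
  moreover have "cmod (fourier_int (q n 0) \<xi>) \<le> L" "\<bar>\<xi>\<bar> * cmod (fourier_int (q n 0) \<xi>) \<le> L" for \<xi>
    using L2(1)[of \<xi>] L3'[of \<xi>] \<open>L2 \<le> L\<close> \<open>L3 \<le> L\<close> by linarith+
  ultimately show ?thesis by (intro exI[of _ L] conjI allI)
qed

end

subsection \<open>Sobolev norms\<close>

lemma ennsqrt_le: "0 \<le> c \<Longrightarrow> a \<le> ennreal (c\<^sup>2) \<Longrightarrow> ennsqrt a \<le> ennreal c"
  unfolding ennsqrt_def
  by (cases a) (auto simp: ennreal_le_iff top_unique intro!: real_le_lsqrt ennreal_leI)

lemma ennsqrt_greater: "0 \<le> c \<Longrightarrow> ennreal (c\<^sup>2) < a \<Longrightarrow> ennreal c < ennsqrt a"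
  unfolding ennsqrt_def
  by (cases a) (auto simp: ennreal_less_iff intro!: ennreal_lessI real_less_rsqrt)

lemma ennsqrt_less: "0 < c \<Longrightarrow> a < ennreal (c\<^sup>2) \<Longrightarrow> ennsqrt a < ennreal c"
  unfolding ennsqrt_def
  by (cases a) (auto simp: ennreal_less_iff intro!: ennreal_lessI real_less_lsqrt)

text \<open>Fatou's lemma and dominated convergence act on the squared norm; the root is taken at
  the very end.\<close>

definition sobolev_energy :: "real \<Rightarrow> (real \<Rightarrow> real) \<Rightarrow> ennreal" where
  "sobolev_energy s f = (\<integral>\<^sup>+ \<xi>. ennreal ((1 + \<xi>\<^sup>2) powr s * (cmod (fourier f \<xi>))\<^sup>2) \<partial>lborel)"

lemma sobolev_norm_energy: "sobolev_norm s f = ennsqrt (sobolev_energy s f)"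
  by (simp add: sobolev_norm_def sobolev_energy_def)

lemma cmod_fourier_scaled:
  assumes l: "l \<noteq> 0"
  shows "(cmod (fourier (\<lambda>x. l * f (l * x)) \<eta>))\<^sup>2 = (cmod (fourier_int f (\<eta> / l)))\<^sup>2 / (2 * pi)"
proof -
  have "fourier_int (\<lambda>x. l * f (l * x)) \<eta> = complex_of_real l * fourier_int (\<lambda>x. f (l * (x - 0))) \<eta>"
    unfolding fourier_int_def integral_mult_right_zero[symmetric]
    by (intro Bochner_Integration.integral_cong) auto
  also have "\<dots> = complex_of_real l * (fourier_int f (\<eta> / l) / \<bar>l\<bar>)"
    by (subst fourier_int_affine[OF l]) simp
  finally have "cmod (fourier_int (\<lambda>x. l * f (l * x)) \<eta>) = cmod (fourier_int f (\<eta> / l))"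
    using l by (simp add: norm_mult norm_divide)
  then have "cmod (fourier (\<lambda>x. l * f (l * x)) \<eta>) = cmod (fourier_int f (\<eta> / l)) / sqrt (2 * pi)"
    unfolding fourier_def fourier_int_def[symmetric] by (simp add: norm_mult norm_divide)
  then show ?thesis by (simp add: power_divide)
qed

lemma fourier_int_measurable [measurable]:
  assumes [measurable]: "f \<in> borel_measurable borel"
  shows "fourier_int f \<in> borel_measurable borel"
proof -
  have [measurable]: "cis \<in> borel_measurable borel"
    by (intro borel_measurable_continuous_onI continuous_intros)
  show ?thesis unfolding fourier_int_def[abs_def] by measurable
qed

section \<open>Energies of the rescaled multisoliton\<close>

context soliton_train
begin

definition scaled :: "nat \<Rightarrow> real \<Rightarrow> real \<Rightarrow> real \<Rightarrow> real" where
  "scaled n l t x = l * q n (l ^ 3 * t) (l * x)"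

lemma schwartz_solution_scaled: "l \<noteq> 0 \<Longrightarrow> schwartz_solution_mkdv (scaled n l)"
  using schwartz_scaled[of l n] unfolding scaled_def[abs_def] .

lemma q_measurable [measurable]: "q n t \<in> borel_measurable borel"
  by (rule exp_decay_measurable[OF exp_decay_G[OF q_G]])

lemma cmod_fourier_scaled_q:
  "l \<noteq> 0 \<Longrightarrow> (cmod (fourier (scaled n l t) \<eta>))\<^sup>2 = (cmod (fourier_int (q n (l ^ 3 * t)) (\<eta> / l)))\<^sup>2 / (2 * pi)"
  unfolding scaled_def[abs_def] by (rule cmod_fourier_scaled)

text \<open>Fatou's lemma applied to the pointwise limit at internal time |l|. The condition l^3 t =
  |l| admits both signs of t: it forces l to have the sign of t, and t = sgn l / l^2.\<close>

lemma energy_liminf: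
  fixes l t :: "nat \<Rightarrow> real"
  assumes l: "\<And>j. l j \<noteq> 0" and lim: "filterlim (\<lambda>j. \<bar>l j\<bar>) at_top sequentially"
    and t: "\<And>j. l j ^ 3 * t j = \<bar>l j\<bar>"
  shows "ennreal (sech_mass\<^sup>2 / (2 * pi)) * (\<integral>\<^sup>+ \<eta>. ennreal ((1 + \<eta>\<^sup>2) powr s * (cmod (profile n \<eta>))\<^sup>2) \<partial>lborel)
    \<le> liminf (\<lambda>j. sobolev_energy s (scaled n (l j) (t j)))"
proof -
  define u where "u j \<eta> = ennreal ((1 + \<eta>\<^sup>2) powr s * ((cmod (fourier_int (q n \<bar>l j\<bar>) (\<eta> / l j)))\<^sup>2 / (2 * pi)))" for j \<eta>
  have u: "sobolev_energy s (scaled n (l j) (t j)) = (\<integral>\<^sup>+ \<eta>. u j \<eta> \<partial>lborel)" for j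
    unfolding sobolev_energy_def u_def cmod_fourier_scaled_q[OF l] t ..
  have abs: "cmod (fourier_int (q n \<bar>l j\<bar>) (\<eta> / l j)) = cmod (fourier_int (q n \<bar>l j\<bar>) (\<eta> / \<bar>l j\<bar>))" for j \<eta>
    using fourier_int_minus[of "q n \<bar>l j\<bar>" "\<eta> / l j"] by (cases "l j > 0") (auto simp: abs_if)
  have pm: "profile n \<in> borel_measurable borel"
    unfolding profile_def[abs_def] by (intro borel_measurable_continuous_onI continuous_intros)
  have ptw: "(\<lambda>j. u j \<eta>) \<longlonglongrightarrow> ennreal (sech_mass\<^sup>2 / (2 * pi)) * ennreal ((1 + \<eta>\<^sup>2) powr s * (cmod (profile n \<eta>))\<^sup>2)" for \<eta>
  proof -
    have "(\<lambda>j. (1 + \<eta>\<^sup>2) powr s * ((cmod (fourier_int (q n \<bar>l j\<bar>) (\<eta> / \<bar>l j\<bar>)))\<^sup>2 / (2 * pi)))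
        \<longlonglongrightarrow> (1 + \<eta>\<^sup>2) powr s * ((cmod (complex_of_real sech_mass * profile n \<eta>))\<^sup>2 / (2 * pi))"
      by (intro tendsto_intros fourier_int_q_limit[OF lim]) auto
    then have "(\<lambda>j. u j \<eta>) \<longlonglongrightarrow> ennreal ((1 + \<eta>\<^sup>2) powr s * ((cmod (complex_of_real sech_mass * profile n \<eta>))\<^sup>2 / (2 * pi)))"
      unfolding u_def abs by (rule tendsto_ennrealI)
    also have "(1 + \<eta>\<^sup>2) powr s * ((cmod (complex_of_real sech_mass * profile n \<eta>))\<^sup>2 / (2 * pi))
        = (sech_mass\<^sup>2 / (2 * pi)) * ((1 + \<eta>\<^sup>2) powr s * (cmod (profile n \<eta>))\<^sup>2)"
      by (simp add: norm_mult power_mult_distrib)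
    finally show ?thesis by (subst ennreal_mult[symmetric]) auto
  qed
  have "ennreal (sech_mass\<^sup>2 / (2 * pi)) * (\<integral>\<^sup>+ \<eta>. ennreal ((1 + \<eta>\<^sup>2) powr s * (cmod (profile n \<eta>))\<^sup>2) \<partial>lborel)
      = (\<integral>\<^sup>+ \<eta>. ennreal (sech_mass\<^sup>2 / (2 * pi)) * ennreal ((1 + \<eta>\<^sup>2) powr s * (cmod (profile n \<eta>))\<^sup>2) \<partial>lborel)"
    using pm by (intro nn_integral_cmult[symmetric]) auto
  also have "\<dots> = (\<integral>\<^sup>+ \<eta>. liminf (\<lambda>j. u j \<eta>) \<partial>lborel)"
    by (intro nn_integral_cong lim_imp_Liminf[symmetric] ptw) simp
  also have "\<dots> \<le> liminf (\<lambda>j. \<integral>\<^sup>+ \<eta>. u j \<eta> \<partial>lborel)"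
    unfolding u_def by (intro nn_integral_liminf) measurable
  finally show ?thesis unfolding u .
qed

text \<open>The substitution \<eta> = l \<xi> shows the scale invariance; what remains is an
  integrand dominated by a multiple of 1 / (1 + \<xi>^2).\<close>

lemma hom_norm_initial:
  assumes n: "even n"
  shows "\<exists>C. \<forall>l. l \<noteq> 0 \<longrightarrow> hom_sobolev_norm (- 1 / 2) (scaled n l 0) \<le> ennreal C"
proof -
  obtain L where L: "L \<ge> 0" "\<And>\<xi>. cmod (fourier_int (q n 0) \<xi>) \<le> L * \<bar>\<xi>\<bar>"
    "\<And>\<xi>. cmod (fourier_int (q n 0) \<xi>) \<le> L" "\<And>\<xi>. \<bar>\<xi>\<bar> * cmod (fourier_int (q n 0) \<xi>) \<le> L"
    using fourier_int_q_initial[OF n] by blast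
  define K where "K = 2 * L\<^sup>2 * (LINT \<xi>|lborel. (1 + \<xi>\<^sup>2) powr (-1))"
  have int: "integrable lborel (\<lambda>\<xi>::real. 2 * L\<^sup>2 * (1 + \<xi>\<^sup>2) powr (-1))"
    by (intro integrable_mult_right integrable_bracket_powr) simp
  have K: "(\<integral>\<^sup>+ \<xi>. ennreal (2 * L\<^sup>2 * (1 + \<xi>\<^sup>2) powr (-1)) \<partial>lborel) = ennreal K"
    unfolding K_def integral_mult_right_zero[symmetric] by (rule nn_integral_eq_integral[OF int]) auto
  have K0: "K \<ge> 0" unfolding K_def by (intro mult_nonneg_nonneg Bochner_Integration.integral_nonneg) auto
  have pw: "y powr (-1) = 1 / y" if "y > 0" for y :: real
    using that by (simp add: powr_minus_divide)
  have ptw: "\<bar>\<xi>\<bar> powr (-1) * ((cmod (fourier_int (q n 0) \<xi>))\<^sup>2 / (2 * pi)) \<le> 2 * L\<^sup>2 * (1 + \<xi>\<^sup>2) powr (-1)" for \<xi>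
  \<comment> \<open>At 0 the left side vanishes by the convention
    \<open>0 powr (-1) = 0\<close>.\<close>
  proof (cases "\<xi> = 0")
    case False
    define g where "g = cmod (fourier_int (q n 0) \<xi>)"
    define z where "z = \<bar>\<xi>\<bar>"
    have z: "z > 0" "\<xi>\<^sup>2 = z\<^sup>2" using False by (auto simp: z_def)
    have g: "g \<ge> 0" "g \<le> L * z" "g \<le> L" "z * g \<le> L" using L by (auto simp: g_def z_def)
    \<comment> \<open>One power of z must survive on the right to offset the weight 1 / z. So in
      each of the two products one factor is bounded by L and the other by L z.\<close>
    have "g * g \<le> (L * z) * L" using g L z by (intro mult_mono) auto
    moreover have "(z * g) * (g * z) \<le> L * (L * z)" using g L z by (intro mult_mono mult_right_mono) auto
    moreover have "(1 + z\<^sup>2) * g\<^sup>2 = g * g + (z * g) * (g * z)" "2 * L\<^sup>2 * z = (L * z) * L + L * (L * z)"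
      by algebra+
    ultimately have "(1 + z\<^sup>2) * g\<^sup>2 \<le> 2 * L\<^sup>2 * z" by linarith
    moreover have pos: "1 + z\<^sup>2 > 0" by (simp add: add_pos_nonneg)
    ultimately have "g\<^sup>2 / z \<le> 2 * L\<^sup>2 / (1 + z\<^sup>2)"
      using z(1) by (simp add: pos_divide_le_eq pos_le_divide_eq mult.commute)
    moreover have "g\<^sup>2 / (2 * pi) \<le> g\<^sup>2 / 1"
      using pi_ge_two by (intro divide_left_mono) auto
    then have "g\<^sup>2 / (2 * pi) / z \<le> g\<^sup>2 / 1 / z" using z by (intro divide_right_mono) auto
    ultimately have "g\<^sup>2 / (2 * pi) / z \<le> 2 * L\<^sup>2 / (1 + z\<^sup>2)" by simp
    moreover have "z powr (-1) * (g\<^sup>2 / (2 * pi)) = g\<^sup>2 / (2 * pi) / z"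
      "2 * L\<^sup>2 * (1 + z\<^sup>2) powr (-1) = 2 * L\<^sup>2 / (1 + z\<^sup>2)"
      unfolding pw[OF z(1)] pw[OF pos] by simp_all
    ultimately show ?thesis unfolding g_def[symmetric] z_def[symmetric] z(2) by linarith
  qed simp
  have "hom_sobolev_norm (- 1 / 2) (scaled n l 0) \<le> ennreal (sqrt K)" if l: "l \<noteq> 0" for l
  proof -
    define h where "h \<eta> = ennreal (\<bar>\<eta>\<bar> powr (-1) * ((cmod (fourier_int (q n 0) (\<eta> / l)))\<^sup>2 / (2 * pi)))" for \<eta>
    have [measurable]: "h \<in> borel_measurable borel" unfolding h_def[abs_def] by measurable
    have "(\<integral>\<^sup>+ \<eta>. h \<eta> \<partial>lborel) = ennreal \<bar>l\<bar> * (\<integral>\<^sup>+ \<xi>. h (0 + l * \<xi>) \<partial>lborel)"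
      by (rule nn_integral_real_affine[OF _ l]) simp
    also have "\<dots> \<le> ennreal \<bar>l\<bar> * (\<integral>\<^sup>+ \<xi>. ennreal (1 / \<bar>l\<bar>) * ennreal (2 * L\<^sup>2 * (1 + \<xi>\<^sup>2) powr (-1)) \<partial>lborel)"
    proof (intro mult_left_mono nn_integral_mono)
      fix \<xi> :: real
      have "\<bar>l * \<xi>\<bar> powr (-1) = (1 / \<bar>l\<bar>) * \<bar>\<xi>\<bar> powr (-1)"
        using l by (cases "\<xi> = 0") (simp_all add: pw abs_mult)
      then have "h (0 + l * \<xi>) = ennreal ((1 / \<bar>l\<bar>) * (\<bar>\<xi>\<bar> powr (-1) * ((cmod (fourier_int (q n 0) \<xi>))\<^sup>2 / (2 * pi))))"
        using l unfolding h_def by (simp add: mult.assoc)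
      also have "\<dots> \<le> ennreal ((1 / \<bar>l\<bar>) * (2 * L\<^sup>2 * (1 + \<xi>\<^sup>2) powr (-1)))"
        by (intro ennreal_leI mult_left_mono ptw) simp
      also have "\<dots> = ennreal (1 / \<bar>l\<bar>) * ennreal (2 * L\<^sup>2 * (1 + \<xi>\<^sup>2) powr (-1))"
        by (rule ennreal_mult) auto
      finally show "h (0 + l * \<xi>) \<le> ennreal (1 / \<bar>l\<bar>) * ennreal (2 * L\<^sup>2 * (1 + \<xi>\<^sup>2) powr (-1))" .
    qed simp
    also have "\<dots> = ennreal \<bar>l\<bar> * (ennreal (1 / \<bar>l\<bar>) * ennreal K)"
      unfolding K[symmetric] by (subst nn_integral_cmult) auto
    also have "\<dots> = ennreal K"
      using l K0 by (simp add: ennreal_mult[symmetric])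
    finally have "(\<integral>\<^sup>+ \<eta>. h \<eta> \<partial>lborel) \<le> ennreal ((sqrt K)\<^sup>2)" using K0 by simp
    then show ?thesis
      unfolding hom_sobolev_norm_def cmod_fourier_scaled_q[OF l] h_def[symmetric]
      using K0 by (intro ennsqrt_le) (auto simp: h_def)
  qed
  then show ?thesis by blast
qed

text \<open>Pointwise the transform at \<eta> / l tends to its value at 0, which is the zero mass. A
  multiple of (1 + \<eta>^2)^s dominates, integrable because s < -1/2.\<close>

lemma energy_initial_tendsto:
  fixes l :: "nat \<Rightarrow> real"
  assumes n: "even n" and s: "s < - 1 / 2"
    and l: "\<And>j. l j \<noteq> 0" and lim: "filterlim l at_top sequentially"
  shows "(\<lambda>j. sobolev_energy s (scaled n (l j) 0)) \<longlonglongrightarrow> 0"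
proof -
  obtain L where L: "L \<ge> 0" "\<And>\<xi>. cmod (fourier_int (q n 0) \<xi>) \<le> L * \<bar>\<xi>\<bar>"
    "\<And>\<xi>. cmod (fourier_int (q n 0) \<xi>) \<le> L"
    using fourier_int_q_initial[OF n] by blast
  define u where "u j \<eta> = ennreal ((1 + \<eta>\<^sup>2) powr s * ((cmod (fourier_int (q n 0) (\<eta> / l j)))\<^sup>2 / (2 * pi)))" for j \<eta>
  have u: "sobolev_energy s (scaled n (l j) 0) = (\<integral>\<^sup>+ \<eta>. u j \<eta> \<partial>lborel)" for j
    unfolding sobolev_energy_def u_def cmod_fourier_scaled_q[OF l] by simp
  have "(\<lambda>j. \<integral>\<^sup>+ \<eta>. u j \<eta> \<partial>lborel) \<longlonglongrightarrow> (\<integral>\<^sup>+ (\<eta>::real). 0 \<partial>lborel)"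
  proof (rule nn_integral_dominated_convergence[where w = "\<lambda>\<eta>. ennreal (L\<^sup>2 / (2 * pi) * (1 + \<eta>\<^sup>2) powr s)"])
    show "u j \<in> borel_measurable lborel" for j unfolding u_def by measurable
    show "AE \<eta> in lborel. u j \<eta> \<le> ennreal (L\<^sup>2 / (2 * pi) * (1 + \<eta>\<^sup>2) powr s)" for j
    proof (rule AE_I2)
      fix \<eta>
      have "(cmod (fourier_int (q n 0) (\<eta> / l j)))\<^sup>2 / (2 * pi) \<le> L\<^sup>2 / (2 * pi)"
        by (intro divide_right_mono power_mono L) auto
      then show "u j \<eta> \<le> ennreal (L\<^sup>2 / (2 * pi) * (1 + \<eta>\<^sup>2) powr s)"
        unfolding u_def by (subst mult.commute) (intro ennreal_leI mult_right_mono, auto)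
    qed
    have "integrable lborel (\<lambda>\<eta>::real. L\<^sup>2 / (2 * pi) * (1 + \<eta>\<^sup>2) powr s)"
      by (intro integrable_mult_right integrable_bracket_powr s)
    then show "(\<integral>\<^sup>+ \<eta>. ennreal (L\<^sup>2 / (2 * pi) * (1 + \<eta>\<^sup>2) powr s) \<partial>lborel) < \<infinity>"
      by (subst nn_integral_eq_integral) auto
    show "AE \<eta> in lborel. (\<lambda>j. u j \<eta>) \<longlonglongrightarrow> 0"
    proof (rule AE_I2)
      fix \<eta> :: real
      have inv: "(\<lambda>j. \<eta> / l j) \<longlonglongrightarrow> 0"
        by (rule tendsto_divide_0[OF tendsto_const]) (rule filterlim_mono[OF lim at_top_le_at_infinity order.refl])
      have "(\<lambda>j. fourier_int (q n 0) (\<eta> / l j)) \<longlonglongrightarrow> 0"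
      proof (rule Lim_null_comparison)
        show "\<forall>\<^sub>F j in sequentially. norm (fourier_int (q n 0) (\<eta> / l j)) \<le> L * \<bar>\<eta> / l j\<bar>"
          by (intro always_eventually allI L)
        show "(\<lambda>j. L * \<bar>\<eta> / l j\<bar>) \<longlonglongrightarrow> 0"
          using tendsto_mult_left[OF tendsto_rabs_zero[OF inv], of L] by simp
      qed
      then have "(\<lambda>j. (1 + \<eta>\<^sup>2) powr s * ((cmod (fourier_int (q n 0) (\<eta> / l j)))\<^sup>2 / (2 * pi)))
          \<longlonglongrightarrow> (1 + \<eta>\<^sup>2) powr s * ((cmod 0)\<^sup>2 / (2 * pi))"
        by (intro tendsto_intros) auto
      from tendsto_ennrealI[OF this] show "(\<lambda>j. u j \<eta>) \<longlonglongrightarrow> 0"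
        unfolding u_def by simp
    qed
  qed auto
  then show ?thesis unfolding u by simp
qed

end

section \<open>Energy of the limiting profile\<close>

text \<open>With this choice the soliton centres at time \<open>T\<close> lie near \<open>(i + 1)\<^sup>2 T\<close>, so that the
  limiting Fourier profile is a trigonometric polynomial with integer frequencies.\<close>

interpretation integer_train: soliton_train "\<lambda>i. (real i + 1) / 2"
  by unfold_locales (auto simp: strict_mono_def)

text \<open>Parseval: the frequencies (i + 1)^2 are distinct integers, so the mixed terms integrate
  to zero and each soliton contributes 2 pi. Half-open periods tile the positive axis.\<close>

lemma profile_period_integral:
  fixes m n :: nat
  shows "(\<integral>\<^sup>+ \<eta>. ennreal ((cmod (integer_train.profile n \<eta>))\<^sup>2) * indicator {2 * pi * m<..2 * pi * Suc m} \<eta> \<partial>lborel)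
    = ennreal (2 * pi * n)"
proof -
  define e where "e i = ((-1) ^ (n - 1 - i) :: real)" for i
  define a where "a i = (real i + 1)\<^sup>2" for i :: nat
  define \<Phi> where "\<Phi> \<eta> = (\<Sum>i<n. \<Sum>j<n. if i = j then \<eta> else e i * e j * (sin ((a i - a j) * \<eta>) / (a i - a j)))" for \<eta>
  have a_inj: "a i \<noteq> a j" if "i \<noteq> j" for i j
    using that unfolding a_def by (simp add: power2_eq_iff)
  have e2: "e i * e i = 1" for i unfolding e_def by (simp add: power_add[symmetric] mult_2[symmetric])
  have sq: "(cmod (integer_train.profile n \<eta>))\<^sup>2 = (\<Sum>i<n. \<Sum>j<n. e i * e j * cos ((a i - a j) * \<eta>))" for \<eta>
  proof -
    have P: "integer_train.profile n \<eta> = (\<Sum>i<n. complex_of_real (e i) * cis (- (a i * \<eta>)))"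
      unfolding integer_train.profile_def e_def a_def by (simp add: power_divide)
    have "(cmod (integer_train.profile n \<eta>))\<^sup>2 = Re (integer_train.profile n \<eta> * cnj (integer_train.profile n \<eta>))"
      by (simp add: complex_norm_square[symmetric])
    also have "\<dots> = (\<Sum>i<n. \<Sum>j<n. Re (complex_of_real (e i) * cis (- (a i * \<eta>)) * cnj (complex_of_real (e j) * cis (- (a j * \<eta>)))))"
      unfolding P by (simp only: cnj_sum sum_product Re_sum)
    also have "\<dots> = (\<Sum>i<n. \<Sum>j<n. e i * e j * cos ((a i - a j) * \<eta>))"
      by (intro sum.cong refl) (simp add: left_diff_distrib cos_diff algebra_simps)
    finally show ?thesis .
  qed
  have deriv: "(\<Phi> has_real_derivative (cmod (integer_train.profile n \<eta>))\<^sup>2) (at \<eta>)" for \<eta>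
    unfolding \<Phi>_def[abs_def] sq
  proof (intro DERIV_sum)
    fix i j
    show "((\<lambda>\<eta>. if i = j then \<eta> else e i * e j * (sin ((a i - a j) * \<eta>) / (a i - a j)))
        has_real_derivative e i * e j * cos ((a i - a j) * \<eta>)) (at \<eta>)"
    proof (cases "i = j")
      case True
      then show ?thesis by (simp add: e2)
    next
      case False
      then have "a i - a j \<noteq> 0" using a_inj by simp
      then show ?thesis using False by (auto intro!: derivative_eq_intros)
    qed
  qed
  have "(\<integral>\<^sup>+ \<eta>. ennreal ((cmod (integer_train.profile n \<eta>))\<^sup>2) * indicator {2 * pi * m<..2 * pi * Suc m} \<eta> \<partial>lborel)
      = (\<integral>\<^sup>+ \<eta>. ennreal ((cmod (integer_train.profile n \<eta>))\<^sup>2) * indicator {2 * pi * m..2 * pi * Suc m} \<eta> \<partial>lborel)"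
    using AE_lborel_singleton[of "2 * pi * m"]
    by (intro nn_integral_cong_AE) (auto elim!: eventually_mono simp: indicator_def)
  also have "\<dots> = ennreal (\<Phi> (2 * pi * Suc m) - \<Phi> (2 * pi * m))"
  proof (rule nn_integral_FTC_Icc)
    show "(\<lambda>\<eta>. (cmod (integer_train.profile n \<eta>))\<^sup>2) \<in> borel_measurable borel"
      unfolding integer_train.profile_def by (intro borel_measurable_continuous_onI continuous_intros)
  qed (auto intro!: deriv)
  also have "\<Phi> (2 * pi * Suc m) - \<Phi> (2 * pi * m) = (\<Sum>i<n. \<Sum>j<n. if i = j then 2 * pi else 0)"
    unfolding \<Phi>_def sum_subtractf[symmetric]
  proof (intro sum.cong refl)
    fix i j
    have "sin ((a i - a j) * (2 * pi * real p)) = 0" for p :: nat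
    proof -
      \<comment> \<open>Integer frequencies make every off-diagonal sine vanish at both ends of the
        period.\<close>
      have "(a i - a j) * real p \<in> \<int>" unfolding a_def by auto
      from sin_integer_2pi[OF this] show ?thesis by (simp add: mult_ac)
    qed
    then show "(if i = j then 2 * pi * Suc m else e i * e j * (sin ((a i - a j) * (2 * pi * Suc m)) / (a i - a j)))
        - (if i = j then 2 * pi * m else e i * e j * (sin ((a i - a j) * (2 * pi * m)) / (a i - a j)))
        = (if i = j then 2 * pi else 0)"
      by (cases "i = j") (simp_all add: distrib_left del: mult_eq_0_iff of_nat_Suc, simp add: algebra_simps)
  qed
  also have "\<dots> = 2 * pi * n" by simp
  finally show ?thesis .
qed

text \<open>For s \<le> 0 the weight decreases on the positive axis, so on each period it is at
  least its value at the right end. Only positive frequencies are counted.\<close>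

lemma profile_energy_lower:
  assumes s: "s \<le> 0"
  shows "ennreal (\<Sum>m<K. (1 + (2 * pi * Suc m)\<^sup>2) powr s * (2 * pi * n))
    \<le> (\<integral>\<^sup>+ \<eta>. ennreal ((1 + \<eta>\<^sup>2) powr s * (cmod (integer_train.profile n \<eta>))\<^sup>2) \<partial>lborel)"
proof -
  define f where "f \<eta> = ennreal ((1 + \<eta>\<^sup>2) powr s * (cmod (integer_train.profile n \<eta>))\<^sup>2)" for \<eta>
  have pm [measurable]: "integer_train.profile n \<in> borel_measurable borel"
    unfolding integer_train.profile_def[abs_def] by (intro borel_measurable_continuous_onI continuous_intros)
  have [measurable]: "f \<in> borel_measurable borel" unfolding f_def[abs_def] by measurable
  have "ennreal (\<Sum>m<K. (1 + (2 * pi * Suc m)\<^sup>2) powr s * (2 * pi * n))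
      \<le> (\<integral>\<^sup>+ \<eta>. f \<eta> * indicator {0<..2 * pi * K} \<eta> \<partial>lborel)" for K
  proof (induction K)
    case (Suc K)
    let ?A = "{2 * pi * K<..2 * pi * Suc K}"
    have le: "2 * pi * K \<le> 2 * pi * Suc K" by simp
    have nn: "0 \<le> 2 * pi * real K" by simp
    have "ennreal ((1 + (2 * pi * Suc K)\<^sup>2) powr s * (2 * pi * n))
        = ennreal ((1 + (2 * pi * Suc K)\<^sup>2) powr s) *
          (\<integral>\<^sup>+ \<eta>. ennreal ((cmod (integer_train.profile n \<eta>))\<^sup>2) * indicator ?A \<eta> \<partial>lborel)"
      unfolding profile_period_integral by (simp add: ennreal_mult del: of_nat_Suc)
    also have "\<dots> = (\<integral>\<^sup>+ \<eta>. ennreal ((1 + (2 * pi * Suc K)\<^sup>2) powr s) *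
          (ennreal ((cmod (integer_train.profile n \<eta>))\<^sup>2) * indicator ?A \<eta>) \<partial>lborel)"
      by (rule nn_integral_cmult[symmetric]) measurable
    also have "\<dots> \<le> (\<integral>\<^sup>+ \<eta>. f \<eta> * indicator ?A \<eta> \<partial>lborel)"
    proof (rule nn_integral_mono)
      fix \<eta> :: real
      have "ennreal ((1 + (2 * pi * Suc K)\<^sup>2) powr s) * ennreal ((cmod (integer_train.profile n \<eta>))\<^sup>2) \<le> f \<eta>"
        if \<eta>: "\<eta> \<in> ?A"
      proof -
        have "2 * pi * real K < \<eta>" using \<eta> by simp
        then have "\<eta> > 0" by (rule le_less_trans[OF nn])
        then have "\<eta>\<^sup>2 \<le> (2 * pi * Suc K)\<^sup>2" using \<eta> by (intro power_mono) auto
        then have "(1 + (2 * pi * Suc K)\<^sup>2) powr s \<le> (1 + \<eta>\<^sup>2) powr s"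
          using s by (intro powr_mono2') (auto simp: add_pos_nonneg)
        then show ?thesis unfolding f_def
          by (subst ennreal_mult[symmetric]) (auto intro!: ennreal_leI mult_right_mono)
      qed
      then show "ennreal ((1 + (2 * pi * Suc K)\<^sup>2) powr s) *
          (ennreal ((cmod (integer_train.profile n \<eta>))\<^sup>2) * indicator ?A \<eta>) \<le> f \<eta> * indicator ?A \<eta>"
        by (cases "\<eta> \<in> ?A") simp_all
    qed
    finally have "ennreal (\<Sum>m<K. (1 + (2 * pi * Suc m)\<^sup>2) powr s * (2 * pi * n))
        + ennreal ((1 + (2 * pi * Suc K)\<^sup>2) powr s * (2 * pi * n))
        \<le> (\<integral>\<^sup>+ \<eta>. f \<eta> * indicator {0<..2 * pi * K} \<eta> \<partial>lborel) + (\<integral>\<^sup>+ \<eta>. f \<eta> * indicator ?A \<eta> \<partial>lborel)"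
      by (intro add_mono Suc.IH)
    also have "\<dots> = (\<integral>\<^sup>+ \<eta>. f \<eta> * indicator {0<..2 * pi * K} \<eta> + f \<eta> * indicator ?A \<eta> \<partial>lborel)"
      by (rule nn_integral_add[symmetric]) measurable
    also have "\<dots> = (\<integral>\<^sup>+ \<eta>. f \<eta> * indicator {0<..2 * pi * Suc K} \<eta> \<partial>lborel)"
    proof (rule nn_integral_cong)
      fix \<eta> :: real
      show "f \<eta> * indicator {0<..2 * pi * K} \<eta> + f \<eta> * indicator ?A \<eta> = f \<eta> * indicator {0<..2 * pi * Suc K} \<eta>"
      proof (cases "\<eta> \<le> 2 * pi * real K")
        case True
        moreover have "\<eta> \<le> 2 * pi * Suc K" using True le by (rule order_trans)
        ultimately show ?thesis by (simp add: indicator_def del: of_nat_Suc)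
      next
        case False
        moreover have "0 < \<eta>" using False nn by linarith
        ultimately show ?thesis by (simp add: indicator_def del: of_nat_Suc)
      qed
    qed
    finally show ?case
      by (simp add: ennreal_plus[symmetric] sum_nonneg del: ennreal_plus of_nat_Suc)
  qed simp
  also have "(\<integral>\<^sup>+ \<eta>. f \<eta> * indicator {0<..2 * pi * K} \<eta> \<partial>lborel) \<le> (\<integral>\<^sup>+ \<eta>. f \<eta> \<partial>lborel)"
    by (intro nn_integral_mono) (auto simp: indicator_def)
  finally show ?thesis unfolding f_def .
qed

text \<open>At order -1/2 the weight at the end of period m is comparable to 1 / (m + 1), and the
  lower bounds grow like the harmonic series.\<close>

lemma profile_energy_infinite:
  assumes n: "n > 0"
  shows "(\<integral>\<^sup>+ \<eta>. ennreal ((1 + \<eta>\<^sup>2) powr (- 1 / 2) * (cmod (integer_train.profile n \<eta>))\<^sup>2) \<partial>lborel) = \<infinity>"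
    (is "?J = \<infinity>")
proof (rule ccontr)
  assume "?J \<noteq> \<infinity>"
  then obtain r where r: "?J = ennreal r" "r \<ge> 0" by (cases ?J) auto
  have "(\<Sum>m<K. inverse (real (Suc m))) \<le> 8 * r" for K
  proof -
    have "(\<Sum>m<K. inverse (real (Suc m))) \<le> (\<Sum>m<K. 8 * ((1 + (2 * pi * Suc m)\<^sup>2) powr (- 1 / 2) * (2 * pi * n)))"
    proof (rule sum_mono)
      fix m
      let ?x = "2 * pi * real (Suc m)"
      \<comment> \<open>Source of the constant 8: the root of 1 + x^2 is at most 1 + x, hence at
        most 1 + 7 (m + 1), hence at most 8 (m + 1).\<close>
      have "2 * pi \<le> 7" using pi_approx(2) by simp
      then have x: "?x \<ge> 0" "?x \<le> 7 * real (Suc m)" by (simp, rule mult_right_mono) simp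
      have "(1 + ?x\<^sup>2) powr (1 / 2) \<le> 1 + ?x"
        unfolding powr_half_sqrt[OF add_nonneg_nonneg[OF zero_le_one zero_le_power2]]
        using x by (intro real_le_lsqrt) (auto simp: power2_eq_square algebra_simps)
      also have "\<dots> \<le> 8 * real (Suc m)" using x by simp
      finally have le: "(1 + ?x\<^sup>2) powr (1 / 2) \<le> 8 * real (Suc m)" .
      have "0 < 1 + ?x\<^sup>2" by (rule add_pos_nonneg) simp_all
      then have "0 < (1 + ?x\<^sup>2) powr (1 / 2)" by (simp only: powr_gt_zero)
      then have "inverse (8 * real (Suc m)) \<le> inverse ((1 + ?x\<^sup>2) powr (1 / 2))"
        by (rule le_imp_inverse_le[OF le])
      also have "\<dots> = (1 + ?x\<^sup>2) powr (- 1 / 2)" by (simp add: powr_minus[symmetric])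
      finally have a: "inverse (8 * real (Suc m)) \<le> (1 + ?x\<^sup>2) powr (- 1 / 2)" .
      have "1 * 1 \<le> 2 * pi * real n" using n pi_ge_two by (intro mult_mono) auto
      with a have "inverse (8 * real (Suc m)) * 1 \<le> (1 + ?x\<^sup>2) powr (- 1 / 2) * (2 * pi * n)"
        by (intro mult_mono) auto
      then show "inverse (real (Suc m)) \<le> 8 * ((1 + ?x\<^sup>2) powr (- 1 / 2) * (2 * pi * n))"
        by (simp add: field_simps)
    qed
    also have "\<dots> \<le> 8 * r"
      using profile_energy_lower[where s = "- 1 / 2" and K = K and n = n] r unfolding r(1) sum_distrib_left[symmetric]
      by (simp add: ennreal_le_iff)
    finally show ?thesis .
  qed
  then have "summable (\<lambda>m. inverse (real (Suc m)))"
    by (intro summableI_nonneg_bounded) auto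
  then show False using not_summable_harmonic[where 'a = real] summable_Suc_iff[of "\<lambda>m. inverse (real m)"] by simp
qed

section \<open>Choice of the scales and of the number of solitons\<close>

theorem propositionA3:
  shows "(\<forall>t :: nat \<Rightarrow> real. (\<forall>n. t n \<noteq> 0) \<and> t \<longlonglongrightarrow> 0 \<longrightarrow>
            (\<exists>(q :: nat \<Rightarrow> real \<Rightarrow> real \<Rightarrow> real) (C :: real).
               (\<forall>n. schwartz_solution_mkdv (q n)) \<and>
               (\<forall>n. hom_sobolev_norm (- 1 / 2) (q n 0) \<le> ennreal C) \<and>
               ((\<lambda>n. sobolev_norm (- 1 / 2) (q n (t n))) \<longlonglongrightarrow> \<infinity>)))
       \<and>
         (\<forall>\<sigma> :: real. \<sigma> < - 1 / 2 \<longrightarrow>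
            (\<forall>\<epsilon> :: real. \<epsilon> > 0 \<longrightarrow>
               (\<exists>q :: real \<Rightarrow> real \<Rightarrow> real.
                  schwartz_solution_mkdv q \<and>
                  sobolev_norm \<sigma> (q 0) < ennreal \<epsilon> \<and>
                  (SUP t\<in>{t :: real. \<bar>t\<bar> < \<epsilon>}. sobolev_norm \<sigma> (q t)) > ennreal (1 / \<epsilon>))))"
proof (intro conjI allI impI)
  fix t :: "nat \<Rightarrow> real"
  assume "(\<forall>n. t n \<noteq> 0) \<and> t \<longlonglongrightarrow> 0"
  then have t: "\<And>n. t n \<noteq> 0" and t0: "t \<longlonglongrightarrow> 0" by auto
  \<comment> \<open>The solution of l^3 t = |l|: it has the sign of t, and its square is 1 /
    |t|.\<close>
  define l where "l n = sgn (t n) / sqrt \<bar>t n\<bar>" for n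
  have l: "l n \<noteq> 0" for n using t[of n] by (simp add: l_def sgn_eq_0_iff)
  have abs_l: "\<bar>l n\<bar> = inverse (sqrt \<bar>t n\<bar>)" for n
    using t[of n] by (simp add: l_def abs_sgn_eq divide_inverse abs_mult)
  have time: "l n ^ 3 * t n = \<bar>l n\<bar>" for n
  proof -
    have "(sqrt \<bar>t n\<bar>) ^ 3 = \<bar>t n\<bar> * sqrt \<bar>t n\<bar>" by (simp add: power3_eq_cube)
    moreover have "sgn (t n) ^ 3 * t n = \<bar>t n\<bar>" by (simp add: sgn_if power3_eq_cube)
    ultimately show ?thesis using t[of n] unfolding abs_l by (simp add: l_def power_divide divide_simps)
  qed
  have "filterlim (\<lambda>n. inverse (sqrt \<bar>t n\<bar>)) at_top sequentially"
  proof (rule filterlim_inverse_at_top)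
    show "(\<lambda>n. sqrt \<bar>t n\<bar>) \<longlonglongrightarrow> 0"
      using tendsto_real_sqrt[OF tendsto_rabs_zero[OF t0]] by simp
  qed (use t in simp)
  then have lim: "filterlim (\<lambda>n. \<bar>l n\<bar>) at_top sequentially" unfolding abs_l .
  \<comment> \<open>Two is even, as the bound at time 0 requires, and positive, which already makes
    the limiting energy infinite.\<close>
  obtain C where C: "\<And>l. l \<noteq> 0 \<Longrightarrow> hom_sobolev_norm (- 1 / 2) (integer_train.scaled 2 l 0) \<le> ennreal C"
    using integer_train.hom_norm_initial[of 2] by auto
  have "ennreal (sech_mass\<^sup>2 / (2 * pi)) * \<infinity> \<le> liminf (\<lambda>n. sobolev_energy (- 1 / 2) (integer_train.scaled 2 (l n) (t n)))"
    using integer_train.energy_liminf[OF l lim time, of "- 1 / 2" 2] by (simp only: profile_energy_infinite[OF zero_less_numeral])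
  moreover have "ennreal (sech_mass\<^sup>2 / (2 * pi)) * \<infinity> = \<infinity>"
    using sech_mass_pos by (simp add: ennreal_mult_top)
  ultimately have inf: "liminf (\<lambda>n. sobolev_energy (- 1 / 2) (integer_train.scaled 2 (l n) (t n))) = \<infinity>"
    by (simp add: top_unique)
  have "(\<lambda>n. sobolev_norm (- 1 / 2) (integer_train.scaled 2 (l n) (t n))) \<longlonglongrightarrow> \<infinity>"
  proof (rule order_tendstoI)
    fix c :: ennreal assume "c < \<infinity>"
    then obtain r where r: "c = ennreal r" "r \<ge> 0" by (cases c) auto
    have "ennreal (r\<^sup>2) < liminf (\<lambda>n. sobolev_energy (- 1 / 2) (integer_train.scaled 2 (l n) (t n)))"
      unfolding inf by simp
    from less_LiminfD[OF this]
    show "\<forall>\<^sub>F n in sequentially. c < sobolev_norm (- 1 / 2) (integer_train.scaled 2 (l n) (t n))"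
      unfolding r(1) sobolev_norm_energy using r(2) by (auto elim!: eventually_mono intro: ennsqrt_greater)
  qed simp
  then show "\<exists>(q :: nat \<Rightarrow> real \<Rightarrow> real \<Rightarrow> real) (C :: real).
               (\<forall>n. schwartz_solution_mkdv (q n)) \<and>
               (\<forall>n. hom_sobolev_norm (- 1 / 2) (q n 0) \<le> ennreal C) \<and>
               ((\<lambda>n. sobolev_norm (- 1 / 2) (q n (t n))) \<longlonglongrightarrow> \<infinity>)"
    using integer_train.schwartz_solution_scaled[OF l] C[OF l]
    by (intro exI[of _ "\<lambda>n. integer_train.scaled 2 (l n)"] exI[of _ C]) auto
next
  fix \<sigma> \<epsilon> :: real
  assume \<sigma>: "\<sigma> < - 1 / 2" and \<epsilon>: "\<epsilon> > 0"
  \<comment> \<open>A lower bound for the limiting energy per soliton, taken from the first period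
    alone; this is the case \<open>K = 1\<close> below.\<close>
  define b where "b = sech_mass\<^sup>2 / (2 * pi) * ((1 + (2 * pi)\<^sup>2) powr \<sigma> * (2 * pi))"
  have "1 + (2 * pi)\<^sup>2 > 0" by (simp add: add_pos_nonneg)
  then have b: "b > 0" unfolding b_def using sech_mass_pos by (intro mult_pos_pos divide_pos_pos) auto
  obtain N :: nat where N: "(1 / \<epsilon>)\<^sup>2 / b < real N" using reals_Archimedean2 by blast
  \<comment> \<open>Even for mass zero at time 0, and large enough that b n exceeds the square of 1
    / \<epsilon>.\<close>
  define n where "n = 2 * N"
  have "(1 / \<epsilon>)\<^sup>2 < real N * b" using N b by (simp add: pos_divide_less_eq)
  also have "\<dots> \<le> b * real n" using b by (simp add: n_def)
  finally have big: "(1 / \<epsilon>)\<^sup>2 < b * real n" .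
  define l where "l j = real (Suc j)" for j
  define t where "t j = 1 / (l j)\<^sup>2" for j
  have l: "l j \<noteq> 0" for j by (simp add: l_def)
  have lim: "filterlim l at_top sequentially"
    unfolding l_def[abs_def] by (rule filterlim_compose[OF filterlim_real_sequentially filterlim_Suc])
  have "(\<lambda>j. \<bar>l j\<bar>) = l" by (simp add: l_def fun_eq_iff)
  with lim have lim': "filterlim (\<lambda>j. \<bar>l j\<bar>) at_top sequentially" by simp
  have time: "l j ^ 3 * t j = \<bar>l j\<bar>" for j
    by (simp add: t_def l_def power2_eq_square power3_eq_cube del: of_nat_Suc)
  have t_lim: "t \<longlonglongrightarrow> 0"
    unfolding t_def[abs_def]
    by (rule tendsto_divide_0[OF tendsto_const])
      (rule filterlim_mono[OF filterlim_pow_at_top[OF _ lim] at_top_le_at_infinity order.refl], simp)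
  have "ennreal (b * real n) \<le> ennreal (sech_mass\<^sup>2 / (2 * pi)) *
      (\<integral>\<^sup>+ \<eta>. ennreal ((1 + \<eta>\<^sup>2) powr \<sigma> * (cmod (integer_train.profile n \<eta>))\<^sup>2) \<partial>lborel)"
  proof -
    have "ennreal (b * real n) = ennreal (sech_mass\<^sup>2 / (2 * pi)) * ennreal ((1 + (2 * pi)\<^sup>2) powr \<sigma> * (2 * pi * n))"
      unfolding b_def by (simp add: ennreal_mult[symmetric] mult_ac)
    also have "\<dots> \<le> ennreal (sech_mass\<^sup>2 / (2 * pi)) *
      (\<integral>\<^sup>+ \<eta>. ennreal ((1 + \<eta>\<^sup>2) powr \<sigma> * (cmod (integer_train.profile n \<eta>))\<^sup>2) \<partial>lborel)"
      using profile_energy_lower[where s = \<sigma> and K = 1 and n = n] \<sigma> by (intro mult_left_mono) auto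
    finally show ?thesis .
  qed
  also have "\<dots> \<le> liminf (\<lambda>j. sobolev_energy \<sigma> (integer_train.scaled n (l j) (t j)))"
    by (rule integer_train.energy_liminf[OF l lim' time])
  finally have "ennreal ((1 / \<epsilon>)\<^sup>2) < liminf (\<lambda>j. sobolev_energy \<sigma> (integer_train.scaled n (l j) (t j)))"
    by (rule less_le_trans[rotated]) (simp only: ennreal_less_iff[OF zero_le_power2] big)
  then have ev1: "\<forall>\<^sub>F j in sequentially. ennreal ((1 / \<epsilon>)\<^sup>2) < sobolev_energy \<sigma> (integer_train.scaled n (l j) (t j))"
    by (rule less_LiminfD)
  have "(\<lambda>j. sobolev_energy \<sigma> (integer_train.scaled n (l j) 0)) \<longlonglongrightarrow> 0"
    by (rule integer_train.energy_initial_tendsto[OF _ \<sigma> l lim]) (simp add: n_def)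
  then have ev2: "\<forall>\<^sub>F j in sequentially. sobolev_energy \<sigma> (integer_train.scaled n (l j) 0) < ennreal (\<epsilon>\<^sup>2)"
    using \<epsilon> by (intro order_tendstoD(2)) auto
  have ev3: "\<forall>\<^sub>F j in sequentially. \<bar>t j\<bar> < \<epsilon>"
    using order_tendstoD(2)[OF tendsto_rabs_zero[OF t_lim] \<epsilon>] .
  \<comment> \<open>With n fixed, raising the scale makes the initial energy and the time small,
    while the energy at time \<open>t j\<close> stays above its bound; so one scale meets all three
    demands.\<close>
  obtain j where j: "ennreal ((1 / \<epsilon>)\<^sup>2) < sobolev_energy \<sigma> (integer_train.scaled n (l j) (t j))"
    "sobolev_energy \<sigma> (integer_train.scaled n (l j) 0) < ennreal (\<epsilon>\<^sup>2)" "\<bar>t j\<bar> < \<epsilon>"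
    using eventually_happens[OF eventually_conj[OF ev1 eventually_conj[OF ev2 ev3]]] by auto
  have "ennreal (1 / \<epsilon>) < sobolev_norm \<sigma> (integer_train.scaled n (l j) (t j))"
    unfolding sobolev_norm_energy using \<epsilon> j(1) by (intro ennsqrt_greater) auto
  also have "\<dots> \<le> (SUP t\<in>{t :: real. \<bar>t\<bar> < \<epsilon>}. sobolev_norm \<sigma> (integer_train.scaled n (l j) t))"
    using j(3) by (intro SUP_upper) auto
  finally show "\<exists>q :: real \<Rightarrow> real \<Rightarrow> real.
                  schwartz_solution_mkdv q \<and>
                  sobolev_norm \<sigma> (q 0) < ennreal \<epsilon> \<and>
                  (SUP t\<in>{t :: real. \<bar>t\<bar> < \<epsilon>}. sobolev_norm \<sigma> (q t)) > ennreal (1 / \<epsilon>)"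
    using integer_train.schwartz_solution_scaled[OF l[of j], of n] ennsqrt_less[OF \<epsilon> j(2)]
    unfolding sobolev_norm_energy[symmetric] by blast
qed

end
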